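(* Let $\alpha>0$. Let $a$ be the bounded diagonal operator on $\ell^2$ defined by $a e_k=\big(1-\frac{1}{2^k}\big)e_k$ for every $k\ge1$, where $(e_k)_{k\ge1}$ is the canonical basis. Let $1<p<\infty$ and let $\mathcal{L}_a\colon S^p\to S^p$, $x\mapsto ax$, and $\mathcal{R}_a\colon S^p\to S^p$, $x\mapsto xa$, be the left and right multiplication operators by $a$. Assume that $2<p<\infty$. Then $$\sup\Big\{\frac{\|x\|_{p,\mathcal{L}_a,c,\alpha}}{\|x\|_{p,\mathcal{L}_a,r,\alpha}}: x\in S^p\Big\}=\infty\quad\text{and}\quad \sup\Big\{\frac{\|x\|_{p,\mathcal{R}_a,r,\alpha}}{\|x\|_{p,\mathcal{R}_a,c,\alpha}}: x\in S^p\Big\}=\infty.$$ Assume that $1<p<2$. Then $$\sup\Big\{\frac{\|x\|_{p,\mathcal{L}_a,r,\alpha}}{\|x\|_{p,\mathcal{L}_a,c,\alpha}}: x\in S^p\Big\}=\infty\quad\text{and}\quad \sup\Big\{\frac{\|x\|_{p,\mathcal{R}_a,c,\alpha}}{\|x\|_{p,\mathcal{R}_a,r,\alpha}}: x\in S^p\Big\}=\infty.$$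
   Context: $S^p$ is the Schatten class of compact operators $x$ on $\ell^2$ with $\|x\|_{S^p}=(\mathrm{Tr}(x^*x)^{p/2})^{1/p}<\infty$. $S^p(\ell^2_c)$ and $S^p(\ell^2_r)$ are the completions of $S^p\otimes\ell^2$ for the norms determined by $\|\sum_{k=1}^n x_k\otimes e_k\|_{S^p(\ell^2_c)}=\|(\sum_k|x_k|^2)^{1/2}\|_{S^p}$ and $\|\sum_{k=1}^n x_k\otimes e_k\|_{S^p(\ell^2_r)}=\|(\sum_k|x_k^*|^2)^{1/2}\|_{S^p}$, where $|x|=(x^*x)^{1/2}$; they are identified with spaces of sequences $(x_k)_{k\ge1}$ in $S^p$ such that $\sum_k x_k\otimes e_k$ converges in the respective norm. A bounded operator $T$ on a Banach space is a Ritt operator if the sets $\{T^n: n\ge0\}$ and $\{n(T^n-T^{n-1}): n\geq1\}$ are bounded; then $I-T$ is sectorial, so the (bounded) fractional power $(I-T)^\alpha$ is defined for $\alpha>0$. The operators $\mathcal{L}_a$ and $\mathcal{R}_a$ are Ritt operators. For a Ritt operator $T$ on $S^p$, $\alpha>0$ and $x\in S^p$, $\|x\|_{p,T,c,\alpha}$ is the norm of $\big(k^{\alpha-\frac12}T^{k-1}(I-T)^\alpha x\big)_{k\ge1}$ in $S^p(\ell^2_c)$ if this sequence belongs to that space, and $+\infty$ otherwise; $\|x\|_{p,T,r,\alpha}$ is defined in the same way with $S^p(\ell^2_r)$. The assertion that a supremum of quotients $\sup\{N_1(x)/N_2(x): x\in S^p\}$ equals $\infty$ means that there is no finite constant $K$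 such that $N_1(x)\le K N_2(x)$ for all $x\in S^p$. *)

theory Defs
  imports "HOL-Analysis.Analysis" "HOL-Computational_Algebra.Polynomial"
begin

section \<open>The complex Hilbert space of square-summable sequences\<close>

typedef ell2 = "{f :: nat \<Rightarrow> complex. summable (\<lambda>n. (cmod (f n))\<^sup>2)}"
  morphisms coord Abs_ell2
  by (rule exI[of _ "\<lambda>_. 0"]) simp

lemma ell2_eqI: "(\<And>n. coord x n = coord y n) \<Longrightarrow> x = y"
  by (metis coord_inject ext)

lemma summable_coord: "summable (\<lambda>n. (cmod (coord x n))\<^sup>2)"
  using coord[of x] by simp

lemma coord_Abs_ell2: "summable (\<lambda>n. (cmod (f n))\<^sup>2) \<Longrightarrow> coord (Abs_ell2 f) = f"
  by (simp add: Abs_ell2_inverse)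

lemma summable_cmod_sq_scale:
  fixes c :: complex
  assumes "summable (\<lambda>n. (cmod (f n))\<^sup>2)"
  shows "summable (\<lambda>n. (cmod (c * f n))\<^sup>2)"
  using summable_mult[OF assms, of "(cmod c)\<^sup>2"] by (simp add: norm_mult power_mult_distrib)

lemma summable_cmod_sq_add:
  assumes "summable (\<lambda>n. (cmod (f n))\<^sup>2)" "summable (\<lambda>n. (cmod (g n))\<^sup>2)"
  shows "summable (\<lambda>n. (cmod (f n + g n))\<^sup>2)"
proof (rule summable_comparison_test_ev)
  show "summable (\<lambda>n. 2 * (cmod (f n))\<^sup>2 + 2 * (cmod (g n))\<^sup>2)"
    using assms by (intro summable_add summable_mult)
  have "(cmod (f n + g n))\<^sup>2 \<le> 2 * (cmod (f n))\<^sup>2 + 2 * (cmod (g n))\<^sup>2" for n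
  proof -
    have "(cmod (f n + g n))\<^sup>2 \<le> (cmod (f n) + cmod (g n))\<^sup>2"
      by (intro power_mono norm_triangle_ineq) auto
    also have "\<dots> \<le> 2 * (cmod (f n))\<^sup>2 + 2 * (cmod (g n))\<^sup>2"
      using zero_le_power2[of "cmod (f n) - cmod (g n)"]
      by (simp add: power2_eq_square algebra_simps)
    finally show ?thesis .
  qed
  then show "\<forall>\<^sub>F n in sequentially.
      norm ((cmod (f n + g n))\<^sup>2) \<le> 2 * (cmod (f n))\<^sup>2 + 2 * (cmod (g n))\<^sup>2"
    by simp
qed

lemma summable_cnj_mult_coord: "summable (\<lambda>n. cnj (coord x n) * coord y n)"
proof (rule summable_comparison_test_ev)
  show "summable (\<lambda>n. (cmod (coord x n))\<^sup>2 + (cmod (coord y n))\<^sup>2)"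
    by (intro summable_add summable_coord)
  have "cmod (coord x n) * cmod (coord y n) \<le> (cmod (coord x n))\<^sup>2 + (cmod (coord y n))\<^sup>2" for n
    using sum_squares_bound[of "cmod (coord x n)" "cmod (coord y n)"]
      mult_nonneg_nonneg[OF norm_ge_zero[of "coord x n"] norm_ge_zero[of "coord y n"]]
    by linarith
  then show "\<forall>\<^sub>F n in sequentially. norm (cnj (coord x n) * coord y n)
      \<le> (cmod (coord x n))\<^sup>2 + (cmod (coord y n))\<^sup>2"
    by (simp add: norm_mult)
qed

definition ell2_scaleC :: "complex \<Rightarrow> ell2 \<Rightarrow> ell2"
  where "ell2_scaleC c x = Abs_ell2 (\<lambda>n. c * coord x n)"

definition ell2_cinner :: "ell2 \<Rightarrow> ell2 \<Rightarrow> complex"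
  where "ell2_cinner x y = (\<Sum>n. cnj (coord x n) * coord y n)"

lemma coord_scaleC: "coord (ell2_scaleC c x) n = c * coord x n"
  by (simp add: ell2_scaleC_def coord_Abs_ell2 summable_cmod_sq_scale summable_coord)

instantiation ell2 :: real_inner
begin

definition zero_ell2 :: ell2 where "0 = Abs_ell2 (\<lambda>_. 0)"
definition plus_ell2 :: "ell2 \<Rightarrow> ell2 \<Rightarrow> ell2"
  where "x + y = Abs_ell2 (\<lambda>n. coord x n + coord y n)"
definition uminus_ell2 :: "ell2 \<Rightarrow> ell2"
  where "- x = Abs_ell2 (\<lambda>n. - coord x n)"
definition minus_ell2 :: "ell2 \<Rightarrow> ell2 \<Rightarrow> ell2"
  where "x - y = x + (- y :: ell2)"
definition scaleR_ell2 :: "real \<Rightarrow> ell2 \<Rightarrow> ell2"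
  where "r *\<^sub>R x = ell2_scaleC (of_real r) x"
definition inner_ell2 :: "ell2 \<Rightarrow> ell2 \<Rightarrow> real"
  where "inner x y = Re (ell2_cinner x y)"
definition norm_ell2 :: "ell2 \<Rightarrow> real"
  where "norm x = sqrt (inner x (x :: ell2))"
definition dist_ell2 :: "ell2 \<Rightarrow> ell2 \<Rightarrow> real"
  where "dist x y = norm (x - y :: ell2)"
definition sgn_ell2 :: "ell2 \<Rightarrow> ell2"
  where "sgn (x :: ell2) = inverse (norm x) *\<^sub>R x"
definition uniformity_ell2 :: "(ell2 \<times> ell2) filter"
  where "uniformity_ell2 = (INF e\<in>{0<..}. principal {(x :: ell2, y). dist x y < e})"
definition open_ell2 :: "ell2 set \<Rightarrow> bool"
  where "open_ell2 (U :: ell2 set) \<longleftrightarrow> (\<forall>x\<in>U. \<forall>\<^sub>F (x', y) in uniformity. x' = x \<longrightarrow> y \<in> U)"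

lemma coord_zero: "coord 0 n = 0"
  by (simp add: zero_ell2_def coord_Abs_ell2)

lemma coord_plus: "coord (x + y) n = coord x n + coord y n"
  by (simp add: plus_ell2_def coord_Abs_ell2 summable_cmod_sq_add summable_coord)

lemma coord_uminus: "coord (- x) n = - coord x n"
  by (simp add: uminus_ell2_def coord_Abs_ell2 summable_coord)

lemma coord_minus: "coord (x - y) n = coord x n - coord y n"
  by (simp add: minus_ell2_def coord_plus coord_uminus)

lemma coord_scaleR: "coord (r *\<^sub>R x) n = of_real r * coord x n"
  by (simp add: scaleR_ell2_def coord_scaleC)

lemmas coord_simps = coord_zero coord_plus coord_uminus coord_minus coord_scaleR

lemma inner_ell2_sums: "(\<lambda>n. Re (cnj (coord x n) * coord y n)) sums inner x y"
  unfolding inner_ell2_def ell2_cinner_def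
  by (intro sums_Re summable_sums summable_cnj_mult_coord)

lemma Re_cnj_mult_self: "Re (cnj z * z) = (cmod z)\<^sup>2"
  by (simp only: cmod_power2) (simp add: power2_eq_square)

instance
proof
  fix x y z :: ell2 and a b r :: real
  show "x + y + z = x + (y + z)" "x + y = y + x" "0 + x = x" "- x + x = 0" "x - y = x + - y"
    "a *\<^sub>R (x + y) = a *\<^sub>R x + a *\<^sub>R y" "(a + b) *\<^sub>R x = a *\<^sub>R x + b *\<^sub>R x"
    "a *\<^sub>R b *\<^sub>R x = (a * b) *\<^sub>R x" "1 *\<^sub>R x = x"
    by (rule ell2_eqI, simp add: coord_simps algebra_simps)+
  show "dist x y = norm (x - y)" by (rule dist_ell2_def)
  show "sgn x = inverse (norm x) *\<^sub>R x" by (rule sgn_ell2_def)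
  show "norm x = sqrt (inner x x)" by (rule norm_ell2_def)
  show "uniformity = (INF e\<in>{0<..}. principal {(x, y :: ell2). dist x y < e})"
    by (rule uniformity_ell2_def)
  show "open U \<longleftrightarrow> (\<forall>x\<in>U. \<forall>\<^sub>F (x', y) in uniformity. x' = x \<longrightarrow> y \<in> U)"
    for U :: "ell2 set"
    by (rule open_ell2_def)
  show "inner x y = inner y x"
    by (rule sums_unique2[OF inner_ell2_sums])
       (use inner_ell2_sums[of y x] in \<open>simp add: algebra_simps\<close>)
  show "inner (x + y) z = inner x z + inner y z"
    by (rule sums_unique2[OF inner_ell2_sums])
       (use sums_add[OF inner_ell2_sums[of x z] inner_ell2_sums[of y z]] in
         \<open>simp add: coord_simps algebra_simps\<close>)
  show "inner (r *\<^sub>R x) y = r * inner x y"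
    by (rule sums_unique2[OF inner_ell2_sums])
       (use sums_mult[OF inner_ell2_sums[of x y], of r] in
         \<open>simp add: coord_simps algebra_simps\<close>)
  have sq: "(\<lambda>n. (cmod (coord x n))\<^sup>2) sums inner x x"
    using inner_ell2_sums[of x x] unfolding Re_cnj_mult_self .
  show "0 \<le> inner x x"
    by (rule sums_le[OF _ sums_zero sq]) simp
  show "inner x x = 0 \<longleftrightarrow> x = 0"
  proof
    assume "inner x x = 0"
    then have "\<forall>n. (cmod (coord x n))\<^sup>2 = 0"
      using sq suminf_eq_zero_iff[OF summable_coord[of x]] sums_unique[OF sq] by simp
    then show "x = 0" by (intro ell2_eqI) (simp add: coord_simps)
  next
    assume "x = 0"
    then show "inner x x = 0"
      using sq by (auto simp: coord_simps dest: sums_unique2[OF sums_zero])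
  qed
qed

end

text \<open>
  The canonical basis is indexed from 0: \<open>ket k\<close> is the vector usually written $e_{k+1}$.
\<close>

definition ket :: "nat \<Rightarrow> ell2"
  where "ket k = Abs_ell2 (\<lambda>n. if n = k then 1 else 0)"


section \<open>Operators on \<open>\<ell>\<^sup>2\<close>\<close>

text \<open>
  Elements of \<open>op\<close> are only real-linear; the operators of the theory are those that moreover
  satisfy \<open>complex_linear\<close>. The norm on \<open>op\<close> is the operator norm.
\<close>

type_synonym op = "ell2 \<Rightarrow>\<^sub>L ell2"

definition complex_linear :: "op \<Rightarrow> bool"
  where "complex_linear x \<longleftrightarrow> (\<forall>c v. x (ell2_scaleC c v) = ell2_scaleC c (x v))"

definition compact_op :: "op \<Rightarrow> bool"
  where "compact_op x \<longleftrightarrow> compact (closure (blinfun_apply x ` cball 0 1))"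

definition adj :: "op \<Rightarrow> op"
  where "adj x = (THE y :: op. \<forall>u v. ell2_cinner (x u) v = ell2_cinner u (y v))"

definition op_poly :: "real poly \<Rightarrow> op \<Rightarrow> op"
  where "op_poly P x = (\<Sum>i\<le>degree P. coeff P i *\<^sub>R ((o\<^sub>L) x ^^ i) id_blinfun)"

text \<open>
  The power \<open>x\<^sup>s\<close> of a positive operator \<open>x\<close>, for \<open>s > 0\<close>, by continuous functional calculus:
  it is the norm limit of \<open>P\<^sub>n(x)\<close> whenever the polynomials \<open>P\<^sub>n\<close> converge to \<open>t \<mapsto> t\<^sup>s\<close> uniformly on
  an interval containing the spectrum of \<open>x\<close>. The value is only meaningful for positive \<open>x\<close>.
\<close>

definition op_powr :: "op \<Rightarrow> real \<Rightarrow> op"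
  where "op_powr x s = (THE y :: op. \<forall>P :: nat \<Rightarrow> real poly.
    uniform_limit {0..norm x} (\<lambda>n. poly (P n)) (\<lambda>t. t powr s) sequentially
      \<longrightarrow> (\<lambda>n. op_poly (P n) x) \<longlonglongrightarrow> y)"

definition op_abs :: "op \<Rightarrow> op"
  where "op_abs x = op_powr (adj x o\<^sub>L x) (1/2)"

text \<open>Trace of a positive operator; for such \<open>x\<close> the diagonal entries are nonnegative reals.\<close>

definition op_trace :: "op \<Rightarrow> ennreal"
  where "op_trace x = (\<Sum>k. ennreal (Re (ell2_cinner (ket k) (x (ket k)))))"


section \<open>Schatten classes and their column and row spaces\<close>

definition schatten :: "real \<Rightarrow> op set"
  where "schatten p = {x. complex_linear x \<and> compact_op x
    \<and> op_trace (op_powr (adj x o\<^sub>L x) (p/2)) < \<infinity>}"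

definition schatten_norm :: "real \<Rightarrow> op \<Rightarrow> real"
  where "schatten_norm p x = enn2real (op_trace (op_powr (adj x o\<^sub>L x) (p/2))) powr (1/p)"

definition fin_col_norm :: "real \<Rightarrow> nat set \<Rightarrow> (nat \<Rightarrow> op) \<Rightarrow> real"
  where "fin_col_norm p I x =
    schatten_norm p (op_powr (\<Sum>k\<in>I. op_abs (x k) o\<^sub>L op_abs (x k)) (1/2))"

definition fin_row_norm :: "real \<Rightarrow> nat set \<Rightarrow> (nat \<Rightarrow> op) \<Rightarrow> real"
  where "fin_row_norm p I x =
    schatten_norm p (op_powr (\<Sum>k\<in>I. op_abs (adj (x k)) o\<^sub>L op_abs (adj (x k))) (1/2))"

text \<open>
  \<open>seq_norm p N x\<close>, for \<open>N\<close> one of the two norms above: a sequence \<open>x\<close> in \<open>S\<^sup>p\<close> belongs to the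
  completion iff the partial sums of $\sum_k x_k \otimes e_k$ form a Cauchy sequence, and then its
  norm is the limit of the norms of the partial sums. Outside the completion the value is
  \<open>\<infinity>\<close>.
\<close>

definition seq_norm ::
    "real \<Rightarrow> (nat set \<Rightarrow> (nat \<Rightarrow> op) \<Rightarrow> real) \<Rightarrow> (nat \<Rightarrow> op) \<Rightarrow> ennreal"
  where "seq_norm p N x =
    (if (\<forall>k. x k \<in> schatten p) \<and> (\<forall>e>0. \<exists>M. \<forall>m\<ge>M. \<forall>n\<ge>m. N {m..<n} x < e)
     then ennreal (lim (\<lambda>n. N {..<n} x)) else \<infinity>)"

definition col_norm :: "real \<Rightarrow> (nat \<Rightarrow> op) \<Rightarrow> ennreal"
  where "col_norm p x = seq_norm p (fin_col_norm p) x"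

definition row_norm :: "real \<Rightarrow> (nat \<Rightarrow> op) \<Rightarrow> ennreal"
  where "row_norm p x = seq_norm p (fin_row_norm p) x"


section \<open>Fractional powers and square functions\<close>

text \<open>
  Fractional power \<open>A\<^sup>\<alpha> x\<close> (\<open>\<alpha> > 0\<close>) of a bounded sectorial operator \<open>A\<close> on \<open>S\<^sup>p\<close>, by Balakrishnan's
  formula
  \[ A^\alpha x = \frac{\Gamma(n)}{\Gamma(\alpha)\Gamma(n-\alpha)}
       \int_0^\infty t^{\alpha-1} \bigl((t+A)^{-1}A\bigr)^n x \, dt, \qquad n > \alpha, \]
  with \<open>n = \<lfloor>\<alpha>\<rfloor> + 1\<close>. The resolvents are those of \<open>A\<close> on \<open>S\<^sup>p\<close>. By sectoriality the integral
  converges absolutely in \<open>S\<^sup>p\<close>; as the operator norm is dominated by the Schatten norm, its value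
  can be computed in the operator norm, which is what \<open>integral\<close> refers to here.
\<close>

definition resolvent :: "real \<Rightarrow> (op \<Rightarrow> op) \<Rightarrow> real \<Rightarrow> op \<Rightarrow> op"
  where "resolvent p A t = inv_into (schatten p) (\<lambda>z. t *\<^sub>R z + A z)"

definition frac_power :: "real \<Rightarrow> (op \<Rightarrow> op) \<Rightarrow> real \<Rightarrow> op \<Rightarrow> op"
  where "frac_power p A \<alpha> x = (let n = nat \<lfloor>\<alpha>\<rfloor> + 1 in
    (Gamma (real n) / (Gamma \<alpha> * Gamma (real n - \<alpha>))) *\<^sub>R
      integral {0<..} (\<lambda>t. t powr (\<alpha> - 1) *\<^sub>R ((\<lambda>z. resolvent p A t (A z)) ^^ n) x))"

text \<open>
  The sequence $(k^{\alpha-1/2}\, T^{k-1}(I-T)^\alpha x)_{k\ge1}$, reindexed to start at 0. It is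
  defined for every map \<open>T\<close>, but only meaningful for a Ritt operator on \<open>S\<^sup>p\<close>, since otherwise
  \<open>frac_power\<close> need not be.
\<close>

definition sq_seq :: "real \<Rightarrow> (op \<Rightarrow> op) \<Rightarrow> real \<Rightarrow> op \<Rightarrow> nat \<Rightarrow> op"
  where "sq_seq p T \<alpha> x k =
    real (Suc k) powr (\<alpha> - 1/2) *\<^sub>R (T ^^ k) (frac_power p (\<lambda>z. z - T z) \<alpha> x)"

definition sq_col :: "real \<Rightarrow> (op \<Rightarrow> op) \<Rightarrow> real \<Rightarrow> op \<Rightarrow> ennreal"
  where "sq_col p T \<alpha> x = col_norm p (sq_seq p T \<alpha> x)"

definition sq_row :: "real \<Rightarrow> (op \<Rightarrow> op) \<Rightarrow> real \<Rightarrow> op \<Rightarrow> ennreal"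
  where "sq_row p T \<alpha> x = row_norm p (sq_seq p T \<alpha> x)"

definition left_mult :: "op \<Rightarrow> op \<Rightarrow> op"
  where "left_mult a x = a o\<^sub>L x"

definition right_mult :: "op \<Rightarrow> op \<Rightarrow> op"
  where "right_mult a x = x o\<^sub>L a"

end

theory Submission
  imports Defs
begin

text \<open>
  Test on the rank-one operators \<open>x = |u\<rangle>\<langle>e|\<close> with \<open>u\<close> the sum of the first \<open>n\<close> basis vectors and \<open>e\<close> a
  unit vector. The sequence defining the square function of \<open>x\<close> under left multiplication is
  \<open>|u\<^sub>k\<rangle>\<langle>e|\<close> for explicit vectors \<open>u\<^sub>k\<close>. Its column norm is \<open>\<tau>\<^bsup>1/2\<^esup>\<close> with \<open>\<tau> = \<Sum>k. \<parallel>u\<^sub>k\<parallel>\<^sup>2\<close>, and its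
  row norm is \<open>(Tr R\<^bsup>p/2\<^esup>)\<^bsup>1/p\<^esup>\<close> with \<open>R = \<Sum>k. |u\<^sub>k\<rangle>\<langle>u\<^sub>k|\<close>. The matrix of \<open>R\<close> decays geometrically away from
  the diagonal, because the numbers \<open>1 - a\<^sub>j = 2\<^bsup>-j\<^esup>\<close> are lacunary; hence \<open>0 \<le> R \<le> C\<close> with \<open>C\<close>
  independent of \<open>n\<close>, whereas \<open>Tr R = \<tau>\<close> grows linearly in \<open>n\<close>. So \<open>Tr R\<^bsup>p/2\<^esup>\<close> is at most (for \<open>p > 2\<close>) or at
  least (for \<open>p < 2\<close>) \<open>C\<^bsup>p/2-1\<^esup> \<tau>\<close>, and \<open>\<tau>\<^bsup>1/2\<^esup>\<close> and \<open>\<tau>\<^bsup>1/p\<^esup>\<close> are not comparable. Right multiplication is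
  the same up to taking adjoints.
\<close>

section \<open>Rank-one operators\<close>

text \<open>The obstacle is that \<open>adj\<close>, \<open>op_powr\<close> and
  \<open>resolvent\<close> are descriptions or choices and \<open>frac_power\<close> is an
  operator-valued integral, so each must be evaluated before anything can be estimated. On the test
  family only finite-rank operators occur: once written as a \<open>diag_op\<close>, their
  polynomials, powers and traces are explicit, and the integral splits into scalar ones. Since the
  test vectors have real coordinates, the spectral theorem is needed only on a finite-dimensional
  real space. The lacunary numbers b_j = 1 - a_j serve twice. Squaring the weight k^(\<alpha> - 1/2)
  gives k^(2\<alpha> - 1), whose geometric sum of ratio r is of order (1 - r)^(-2\<alpha>). Against
  the factor (b_i b_j)^\<alpha> this is homogeneous of degree 0 in the b's: diagonal entries of R
  stay above a fixed positive constant, which makes the trace grow, while the rows are summable,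
  which bounds R.\<close>

lemma coord_ket: "coord (ket k) n = (if n = k then 1 else 0)"
proof -
  have "summable (\<lambda>n. (cmod (if n = k then 1 else 0))\<^sup>2)"
    by (rule summable_finite[of "{k}"]) auto
  then show ?thesis
    unfolding ket_def by (subst coord_Abs_ell2) auto
qed

section \<open>Sesquilinear algebra of \<open>ell2_cinner\<close>\<close>

lemma cinner_add_left: "ell2_cinner (x + y) z = ell2_cinner x z + ell2_cinner y z"
  unfolding ell2_cinner_def coord_plus complex_cnj_add distrib_right
  by (rule suminf_add[symmetric]; rule summable_cnj_mult_coord)

lemma cinner_add_right: "ell2_cinner x (y + z) = ell2_cinner x y + ell2_cinner x z"
  unfolding ell2_cinner_def coord_plus distrib_left
  by (rule suminf_add[symmetric]; rule summable_cnj_mult_coord)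

lemma cinner_scaleC_right: "ell2_cinner x (ell2_scaleC c y) = c * ell2_cinner x y"
  unfolding ell2_cinner_def coord_scaleC
  using suminf_mult[OF summable_cnj_mult_coord, of c x y] by (simp add: ac_simps)

lemma cinner_commute: "ell2_cinner y x = cnj (ell2_cinner x y)"
proof -
  have "(\<lambda>n. cnj (cnj (coord x n) * coord y n)) sums cnj (ell2_cinner x y)"
    unfolding ell2_cinner_def sums_cnj by (intro summable_sums summable_cnj_mult_coord)
  then show ?thesis
    unfolding ell2_cinner_def by (simp add: sums_iff mult.commute)
qed

lemma cinner_scaleC_left: "ell2_cinner (ell2_scaleC c x) y = cnj c * ell2_cinner x y"
  by (subst (1 2) cinner_commute) (simp add: cinner_scaleC_right)

lemma scaleR_eq_scaleC: "r *\<^sub>R x = ell2_scaleC (of_real r) x"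
  by (rule scaleR_ell2_def)

lemma cinner_scaleR_left: "ell2_cinner (r *\<^sub>R x) y = of_real r * ell2_cinner x y"
  by (simp add: scaleR_eq_scaleC cinner_scaleC_left)

lemma cinner_scaleR_right: "ell2_cinner x (r *\<^sub>R y) = of_real r * ell2_cinner x y"
  by (simp add: scaleR_eq_scaleC cinner_scaleC_right)

lemma cinner_zero_left: "ell2_cinner 0 y = 0"
  using cinner_scaleR_left[of 0 0 y] by simp

lemma cinner_zero_right: "ell2_cinner y 0 = 0"
  using cinner_scaleR_right[of y 0 0] by simp

lemma Re_cinner: "Re (ell2_cinner x y) = inner x y"
  by (simp add: inner_ell2_def)

lemma cinner_self: "ell2_cinner x x = of_real ((norm x)\<^sup>2)"
proof -
  have "Im (ell2_cinner x x) = 0"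
    using cinner_commute[of x x] by (metis Reals_cnj_iff complex_is_Real_iff)
  then show ?thesis
    by (simp add: complex_eq_iff Re_cinner power2_norm_eq_inner)
qed

lemma cinner_ket_left: "ell2_cinner (ket k) v = coord v k"
proof -
  have "(\<lambda>n. cnj (coord (ket k) n) * coord v n) sums (cnj (coord (ket k) k) * coord v k)"
    by (rule sums_finite[of "{k}", simplified]) (simp add: coord_ket)
  then show ?thesis unfolding ell2_cinner_def by (simp add: sums_iff coord_ket)
qed

lemma cinner_ket_right: "ell2_cinner v (ket k) = cnj (coord v k)"
  by (subst cinner_commute) (simp add: cinner_ket_left)

lemma norm_sq_sums: "(\<lambda>n. (cmod (coord x n))\<^sup>2) sums (norm x)\<^sup>2"
  using inner_ell2_sums[of x x] unfolding Re_cnj_mult_self power2_norm_eq_inner .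

lemma norm_scaleC: "norm (ell2_scaleC c x) = cmod c * norm x"
proof -
  have "of_real ((norm (ell2_scaleC c x))\<^sup>2) = (of_real ((cmod c * norm x)\<^sup>2) :: complex)"
    unfolding cinner_self[symmetric] cinner_scaleC_left cinner_scaleC_right
    by (simp add: cinner_self power_mult_distrib complex_norm_square[symmetric] mult.assoc[symmetric]
        mult.commute[of "cnj c"])
  then have "(norm (ell2_scaleC c x))\<^sup>2 = (cmod c * norm x)\<^sup>2"
    by (simp only: of_real_eq_iff)
  then show ?thesis by (simp add: power2_eq_iff_nonneg)
qed

lemma norm_ket: "norm (ket k) = 1"
proof -
  have "of_real ((norm (ket k))\<^sup>2) = (of_real 1 :: complex)"
    unfolding cinner_self[symmetric] by (simp add: cinner_ket_left coord_ket)
  then show ?thesis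
    by (simp only: of_real_eq_iff) (metis abs_norm_cancel power2_eq_1_iff abs_1 abs_minus_cancel)
qed

text \<open>Rotating \<open>x\<close> by the phase of the inner product makes that product real and
  nonnegative, so the real Cauchy-Schwarz inequality applies.\<close>

lemma cmod_cinner_le: "cmod (ell2_cinner x y) \<le> norm x * norm y"
proof (cases "ell2_cinner x y = 0")
  case False
  define z where "z = sgn (ell2_cinner x y)"
  have "cmod z = 1" using False by (simp add: z_def norm_sgn)
  have "ell2_cinner (ell2_scaleC z x) y = of_real (cmod (ell2_cinner x y))"
    unfolding cinner_scaleC_left z_def using False
    by (simp add: sgn_div_norm complex_norm_square[symmetric] power2_eq_square scaleR_conv_of_real
        mult.commute[of "cnj _"] divide_simps)
  then have "cmod (ell2_cinner x y) = inner (ell2_scaleC z x) y"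
    by (simp add: Re_cinner[symmetric])
  also have "\<dots> \<le> norm (ell2_scaleC z x) * norm y" by (rule norm_cauchy_schwarz)
  finally show ?thesis by (simp add: norm_scaleC \<open>cmod z = 1\<close>)
qed simp

lemma scaleC_add_right: "ell2_scaleC c (x + y) = ell2_scaleC c x + ell2_scaleC c y"
  and scaleC_add_left: "ell2_scaleC (c + d) x = ell2_scaleC c x + ell2_scaleC d x"
  and scaleC_scaleC: "ell2_scaleC c (ell2_scaleC d x) = ell2_scaleC (c * d) x"
  and scaleC_scaleR: "ell2_scaleC c (r *\<^sub>R x) = r *\<^sub>R ell2_scaleC c x"
  and scaleC_of_real_mult: "ell2_scaleC (of_real r * c) x = r *\<^sub>R ell2_scaleC c x"
  and scaleC_zero_left: "ell2_scaleC 0 x = 0"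
  by (rule ell2_eqI; simp add: coord_scaleC coord_simps algebra_simps)+

lemma coord_sum: "coord (sum f A) n = (\<Sum>i\<in>A. coord (f i) n)"
  by (induction A rule: infinite_finite_induct) (simp_all add: coord_zero coord_plus)

lemma cinner_sum_left: "ell2_cinner (sum f A) y = (\<Sum>i\<in>A. ell2_cinner (f i) y)"
  by (induction A rule: infinite_finite_induct) (simp_all add: cinner_zero_left cinner_add_left)

lemma cinner_sum_right: "ell2_cinner y (sum f A) = (\<Sum>i\<in>A. ell2_cinner y (f i))"
  by (induction A rule: infinite_finite_induct) (simp_all add: cinner_zero_right cinner_add_right)

lemma bounded_linear_coord: "bounded_linear (\<lambda>x. coord x n)"
proof (rule bounded_linear_intro[where K = 1])
  show "norm (coord x n) \<le> norm x * 1" for x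
    using cmod_cinner_le[of "ket n" x] by (simp add: cinner_ket_left norm_ket)
qed (simp_all add: coord_simps scaleR_conv_of_real)

text \<open>The squared norm of the remainder is the tail of a convergent series. This reduces
  statements on bounded complex-linear operators to basis vectors.\<close>

lemma truncation_tendsto:
  "(\<lambda>m. \<Sum>k<m. ell2_scaleC (coord v k) (ket k)) \<longlonglongrightarrow> v"
proof -
  define w where "w = (\<lambda>m. v - (\<Sum>k<m. ell2_scaleC (coord v k) (ket k)))"
  have cw: "coord (w m) n = (if n < m then 0 else coord v n)" for m n
    by (simp add: w_def coord_minus coord_sum coord_scaleC coord_ket if_distrib sum.delta cong: if_cong)
  have "(norm (w m))\<^sup>2 = (norm v)\<^sup>2 - (\<Sum>n<m. (cmod (coord v n))\<^sup>2)" for m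
  proof -
    have "(\<lambda>n. (cmod (coord v n))\<^sup>2 - (if n \<in> {..<m} then (cmod (coord v n))\<^sup>2 else 0))
        sums ((norm v)\<^sup>2 - (\<Sum>n<m. (cmod (coord v n))\<^sup>2))"
      by (intro sums_diff norm_sq_sums sums_If_finite_set) simp
    moreover have "(\<lambda>n. (cmod (coord v n))\<^sup>2 - (if n \<in> {..<m} then (cmod (coord v n))\<^sup>2 else 0)) =
        (\<lambda>n. (cmod (coord (w m) n))\<^sup>2)"
      by (auto simp: cw)
    ultimately show ?thesis
      using norm_sq_sums[of "w m"] by (metis sums_unique2)
  qed
  moreover have "(\<lambda>m. (norm v)\<^sup>2 - (\<Sum>n<m. (cmod (coord v n))\<^sup>2)) \<longlonglongrightarrow> (norm v)\<^sup>2 - (norm v)\<^sup>2"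
    using norm_sq_sums[of v] unfolding sums_def by (intro tendsto_diff tendsto_const)
  ultimately have "(\<lambda>m. (norm (w m))\<^sup>2) \<longlonglongrightarrow> 0" by simp
  then have "(\<lambda>m. sqrt ((norm (w m))\<^sup>2)) \<longlonglongrightarrow> sqrt 0" by (rule tendsto_real_sqrt)
  then have "w \<longlonglongrightarrow> 0" by (simp add: tendsto_norm_zero_iff)
  then have "(\<lambda>m. v - w m) \<longlonglongrightarrow> v - 0" by (intro tendsto_diff tendsto_const)
  then show ?thesis by (simp add: w_def)
qed

text \<open>Complex linearity is essential: elements of \<open>op\<close> are only real-linear, and
  the real span of the vectors \<open>ket k\<close> is not dense.\<close>

lemma complex_linear_eqI:
  fixes x y :: op
  assumes "complex_linear x" "complex_linear y" "\<And>k. x (ket k) = y (ket k)"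
  shows "x = y"
proof (rule blinfun_eqI)
  fix v
  let ?S = "\<lambda>m. \<Sum>k<m. ell2_scaleC (coord v k) (ket k)"
  have "(\<lambda>m. x (?S m)) \<longlonglongrightarrow> x v" "(\<lambda>m. y (?S m)) \<longlonglongrightarrow> y v"
    by (intro blinfun.tendsto tendsto_const truncation_tendsto)+
  moreover have "x (?S m) = y (?S m)" for m
    using assms by (simp add: blinfun.sum_right complex_linear_def)
  ultimately show "x v = y v" by (simp add: LIMSEQ_unique)
qed

lemma diagonal_coord:
  fixes a :: op
  assumes "complex_linear a" "\<And>k. a (ket k) = d k *\<^sub>R ket k"
  shows "coord (a v) j = of_real (d j) * coord v j"
proof -
  let ?S = "\<lambda>m. \<Sum>k<m. ell2_scaleC (coord v k) (ket k)"
  have "(\<lambda>m. coord (a (?S m)) j) \<longlonglongrightarrow> coord (a v) j"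
    by (intro bounded_linear.tendsto[OF bounded_linear_coord] blinfun.tendsto tendsto_const
        truncation_tendsto)
  moreover have "(\<lambda>m. of_real (d j) * coord (?S m) j) \<longlonglongrightarrow> of_real (d j) * coord v j"
    by (intro tendsto_intros bounded_linear.tendsto[OF bounded_linear_coord] truncation_tendsto)
  moreover have "coord (a (?S m)) j = of_real (d j) * coord (?S m) j" for m
    using assms by (simp add: blinfun.sum_right complex_linear_def coord_sum coord_scaleC
        coord_scaleR coord_ket if_distrib sum.delta cong: if_cong)
  ultimately show ?thesis by (simp add: LIMSEQ_unique)
qed

text \<open>Resolves the definite description in \<open>adj\<close>: testing against
  \<open>ket j\<close> recovers every coordinate, so the adjoint is unique.\<close>

lemma adj_eqI:
  fixes x y :: op
  assumes "\<And>u v. ell2_cinner (x u) v = ell2_cinner u (y v)"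
  shows "adj x = y"
  unfolding adj_def
proof (rule the_equality)
  fix z :: op assume z: "\<forall>u v. ell2_cinner (x u) v = ell2_cinner u (z v)"
  show "z = y"
  proof (rule blinfun_eqI)
    fix v
    have "ell2_cinner (ket j) (z v) = ell2_cinner (ket j) (y v)" for j
      using z assms by metis
    then show "z v = y v" by (intro ell2_eqI) (simp add: cinner_ket_left)
  qed
qed (use assms in simp)

text \<open>The operator written |u><v| in the overview.\<close>

lift_definition rk :: "ell2 \<Rightarrow> ell2 \<Rightarrow> op" is "\<lambda>u v w. ell2_scaleC (ell2_cinner v w) u"
proof (rule bounded_linear_intro)
  fix u v w :: ell2
  show "norm (ell2_scaleC (ell2_cinner v w) u) \<le> norm w * (norm v * norm u)"
    using mult_right_mono[OF cmod_cinner_le[of v w], of "norm u"] by (simp add: norm_scaleC ac_simps)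
qed (simp_all add: cinner_add_right scaleC_add_left cinner_scaleR_right scaleC_of_real_mult)

lemma rk_add_left: "rk (u + u') v = rk u v + rk u' v"
  by (rule blinfun_eqI) (simp add: rk.rep_eq blinfun.add_left scaleC_add_right)

lemma rk_add_right: "rk u (v + v') = rk u v + rk u v'"
  by (rule blinfun_eqI) (simp add: rk.rep_eq blinfun.add_left scaleC_add_left cinner_add_left)

lemma rk_scaleR_left: "rk (r *\<^sub>R u) v = r *\<^sub>R rk u v"
  by (rule blinfun_eqI) (simp add: rk.rep_eq blinfun.scaleR_left scaleC_scaleR)

lemma rk_scaleR_right: "rk u (r *\<^sub>R v) = r *\<^sub>R rk u v"
  by (rule blinfun_eqI)
     (simp add: rk.rep_eq blinfun.scaleR_left cinner_scaleR_left scaleC_of_real_mult)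

lemma rk_zero_left: "rk 0 v = 0" and rk_zero_right: "rk u 0 = 0"
  using rk_scaleR_left[of 0 0 v] rk_scaleR_right[of u 0 0] by simp_all

lemma rk_sum_left: "rk (sum f A) v = (\<Sum>i\<in>A. rk (f i) v)"
  by (induction A rule: infinite_finite_induct) (simp_all add: rk_zero_left rk_add_left)

lemma rk_sum_right: "rk u (sum f A) = (\<Sum>i\<in>A. rk u (f i))"
  by (induction A rule: infinite_finite_induct) (simp_all add: rk_zero_right rk_add_right)

lemma rk_adjoint: "ell2_cinner (rk u v x) y = ell2_cinner x (rk v u y)"
  using cinner_commute[of v x] by (simp add: rk.rep_eq cinner_scaleC_left cinner_scaleC_right)

lemma adj_rk: "adj (rk u v) = rk v u"
  by (rule adj_eqI) (rule rk_adjoint)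

lemma complex_linear_rk: "complex_linear (rk u v)"
  by (simp add: complex_linear_def rk.rep_eq cinner_scaleC_right scaleC_scaleC)

lemma rk_comp_rk_orthogonal: "ell2_cinner v u' = 0 \<Longrightarrow> rk u v o\<^sub>L rk u' v' = 0"
  by (rule blinfun_eqI) (simp add: rk.rep_eq cinner_scaleC_right scaleC_zero_left)

lemma rk_comp_rk: "rk u v o\<^sub>L rk v w = (norm v)\<^sup>2 *\<^sub>R rk u w"
  by (rule blinfun_eqI)
     (simp add: rk.rep_eq cinner_scaleC_right cinner_self blinfun.scaleR_left
       flip: scaleC_of_real_mult of_real_power, simp add: mult.commute)

text \<open>The unit ball is mapped into the multiples of \<open>u\<close> by scalars from a compact
  disc.\<close>

lemma compact_op_rk: "compact_op (rk u v)"
proof -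
  let ?f = "\<lambda>c. ell2_scaleC c u"
  have bl: "bounded_linear ?f"
    by (rule bounded_linear_intro[where K = "norm u"])
       (simp_all add: scaleC_add_left norm_scaleC scaleR_conv_of_real scaleC_of_real_mult)
  have "compact (?f ` cball 0 (norm v))"
    by (intro compact_continuous_image linear_continuous_on bl compact_cball)
  moreover have "blinfun_apply (rk u v) ` cball 0 1 \<subseteq> ?f ` cball 0 (norm v)"
  proof safe
    fix w :: ell2 assume "w \<in> cball 0 1"
    then have "cmod (ell2_cinner v w) \<le> norm v"
      using cmod_cinner_le[of v w] mult_left_le[of "norm w" "norm v"] by (simp add: dist_norm)
    then show "rk u v w \<in> ?f ` cball 0 (norm v)" by (auto simp: rk.rep_eq)
  qed
  ultimately show ?thesis
    unfolding compact_op_def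
    by (metis closed_closure closure_minimal compact_Int_closed compact_imp_closed inf.absorb_iff2)
qed

section \<open>Functional calculus of finite-rank operators\<close>

text \<open>\<open>op_powr\<close> quantifies over all approximating sequences of polynomials; the
  existence of one such sequence is what makes the described operator unique.\<close>

lemma exists_poly_uniform_limit:
  fixes f :: "real \<Rightarrow> real"
  assumes "continuous_on {a..b} f"
  obtains P :: "nat \<Rightarrow> real poly"
  where "uniform_limit {a..b} (\<lambda>n. poly (P n)) f sequentially"
proof -
  have "\<exists>P :: real poly. \<forall>x\<in>{a..b}. \<bar>f x - poly P x\<bar> < 1 / Suc n" for n
  proof -
    obtain g where g: "real_polynomial_function g" "\<And>x. x \<in> {a..b} \<Longrightarrow> \<bar>f x - g x\<bar> < 1 / Suc n"
      by (rule Stone_Weierstrass_real_polynomial_function[OF compact_Icc assms, of "1 / Suc n"]) auto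
    then obtain c m where "g = (\<lambda>x. \<Sum>i\<le>m. c i * x ^ i)"
      unfolding real_polynomial_function_iff_sum by auto
    then have "g x = poly (\<Sum>i\<le>m. monom (c i) i) x" for x
      by (simp add: poly_sum poly_monom)
    with g(2) show ?thesis by metis
  qed
  then obtain P :: "nat \<Rightarrow> real poly"
    where P: "\<And>n x. x \<in> {a..b} \<Longrightarrow> \<bar>f x - poly (P n) x\<bar> < 1 / Suc n"
    by metis
  have "uniform_limit {a..b} (\<lambda>n. poly (P n)) f sequentially"
  proof (rule uniform_limitI)
    fix e :: real assume "e > 0"
    then obtain N where N: "N \<noteq> 0" "1 / real N < e" using real_arch_inverse[of e]
      by (auto simp: inverse_eq_divide)
    show "\<forall>\<^sub>F n in sequentially. \<forall>x\<in>{a..b}. dist (poly (P n) x) (f x) < e"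
    proof (rule eventually_sequentiallyI[of N], intro ballI)
      fix n x assume "N \<le> n" "x \<in> {a..b}"
      then have "\<bar>f x - poly (P n) x\<bar> < 1 / Suc n" using P by blast
      also have "\<dots> \<le> 1 / N" using \<open>N \<le> n\<close> N by (intro divide_left_mono) auto
      finally show "dist (poly (P n) x) (f x) < e" using N by (simp add: dist_real_def)
    qed
  qed
  then show ?thesis by (rule that)
qed

definition orthonormal :: "ell2 set \<Rightarrow> bool"
  where "orthonormal B \<longleftrightarrow> finite B \<and> (\<forall>b\<in>B. \<forall>c\<in>B. ell2_cinner b c = (if b = c then 1 else 0))"

text \<open>For orthonormal \<open>B\<close>, a spectral decomposition. \<open>B\<close> is finite,
  so the operator vanishes on the orthogonal complement of \<open>B\<close>, and functional calculus
  must also account for the eigenvalue 0.\<close>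

definition diag_op :: "ell2 set \<Rightarrow> (ell2 \<Rightarrow> real) \<Rightarrow> op"
  where "diag_op B l = (\<Sum>b\<in>B. l b *\<^sub>R rk b b)"

lemma orthonormal_finite: "orthonormal B \<Longrightarrow> finite B"
  by (simp add: orthonormal_def)

lemma orthonormal_norm: "orthonormal B \<Longrightarrow> b \<in> B \<Longrightarrow> norm b = 1"
proof -
  assume "orthonormal B" "b \<in> B"
  then have "complex_of_real ((norm b)\<^sup>2) = of_real 1"
    unfolding cinner_self[symmetric] by (simp add: orthonormal_def)
  then show ?thesis
    by (simp only: of_real_eq_iff) (metis abs_norm_cancel power2_eq_1_iff abs_1 abs_minus_cancel)
qed

lemma diag_op_cong: "(\<And>b. b \<in> B \<Longrightarrow> l b = m b) \<Longrightarrow> diag_op B l = diag_op B m"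
  unfolding diag_op_def by (intro sum.cong) simp_all

lemma diag_op_apply: "diag_op B l w = (\<Sum>b\<in>B. l b *\<^sub>R rk b b w)"
  by (simp add: diag_op_def blinfun.sum_left blinfun.scaleR_left)

lemma adj_diag_op: "adj (diag_op B l) = diag_op B l"
  by (rule adj_eqI)
     (simp add: diag_op_apply cinner_sum_left cinner_sum_right cinner_scaleR_left
       cinner_scaleR_right rk_adjoint)

lemma diag_op_comp:
  assumes "orthonormal B"
  shows "diag_op B l o\<^sub>L diag_op B m = diag_op B (\<lambda>b. l b * m b)"
proof -
  have rk: "rk b b o\<^sub>L rk c c = (if b = c then rk b b else 0)" if "b \<in> B" "c \<in> B" for b c
    using assms that orthonormal_norm[OF assms \<open>b \<in> B\<close>] rk_comp_rk[of b b b]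
      rk_comp_rk_orthogonal[of b c b c] by (auto simp: orthonormal_def)
  have "diag_op B l o\<^sub>L diag_op B m = (\<Sum>b\<in>B. \<Sum>c\<in>B. (l b * m c) *\<^sub>R (rk b b o\<^sub>L rk c c))"
    unfolding diag_op_def
    by (simp add: bounded_bilinear.sum_left[OF bounded_bilinear_blinfun_compose]
        bounded_bilinear.sum_right[OF bounded_bilinear_blinfun_compose]
        bounded_bilinear.scaleR_left[OF bounded_bilinear_blinfun_compose]
        bounded_bilinear.scaleR_right[OF bounded_bilinear_blinfun_compose] scaleR_sum_right mult.commute)
       (rule sum.swap)
  also have "\<dots> = (\<Sum>b\<in>B. \<Sum>c\<in>B. if b = c then (l b * m b) *\<^sub>R rk b b else 0)"
    by (intro sum.cong refl) (auto simp: rk)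
  finally show ?thesis using orthonormal_finite[OF assms] by (simp add: diag_op_def)
qed

lemma diag_op_eigen:
  assumes "orthonormal B" "b \<in> B"
  shows "diag_op B l b = l b *\<^sub>R b"
proof -
  have "diag_op B l b = (\<Sum>c\<in>B. if c = b then l b *\<^sub>R b else 0)"
    unfolding diag_op_apply using assms
    by (intro sum.cong refl) (auto simp: rk.rep_eq orthonormal_def scaleC_zero_left
        scaleC_of_real_mult[of 1 1, simplified] scaleR_eq_scaleC[of 1, symmetric, simplified])
  then show ?thesis using orthonormal_finite assms by simp
qed

lemma abs_eigenvalue_le_norm:
  assumes "orthonormal B" "b \<in> B"
  shows "\<bar>l b\<bar> \<le> norm (diag_op B l)"
  using norm_blinfun[of "diag_op B l" b] orthonormal_norm[OF assms] by (simp add: diag_op_eigen assms)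

text \<open>On the orthogonal complement of \<open>B\<close> a polynomial acts as its value at 0;
  this multiple of the identity is split off so that the rest is again a \<open>diag_op\<close>. In
  the powers, \<open>0 ^ i\<close> singles out i = 0.\<close>

lemma op_poly_diag_op:
  assumes "orthonormal B"
  shows "op_poly P (diag_op B l) =
    poly P 0 *\<^sub>R id_blinfun + diag_op B (\<lambda>b. poly P (l b) - poly P 0)"
proof -
  have pow: "((o\<^sub>L) (diag_op B l) ^^ i) id_blinfun =
    0 ^ i *\<^sub>R id_blinfun + diag_op B (\<lambda>b. l b ^ i - 0 ^ i)" for i
  proof (induction i)
    case 0 then show ?case by (simp add: diag_op_def)
  next
    case (Suc i)
    have "diag_op B l o\<^sub>L id_blinfun = diag_op B l"
      by (rule blinfun_eqI) simp
    then have "diag_op B l o\<^sub>L (0 ^ i *\<^sub>R id_blinfun + diag_op B (\<lambda>b. l b ^ i - 0 ^ i)) =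
      0 ^ i *\<^sub>R diag_op B l + diag_op B (\<lambda>b. l b * (l b ^ i - 0 ^ i))"
      by (simp add: bounded_bilinear.add_right[OF bounded_bilinear_blinfun_compose]
        bounded_bilinear.scaleR_right[OF bounded_bilinear_blinfun_compose] diag_op_comp[OF assms])
    also have "\<dots> = diag_op B (\<lambda>b. l b * l b ^ i)"
      by (simp add: diag_op_def scaleR_sum_right algebra_simps flip: sum.distrib)
    finally show ?case using Suc by simp
  qed
  have "op_poly P (diag_op B l) = (\<Sum>i\<le>degree P. coeff P i *\<^sub>R (0 ^ i *\<^sub>R id_blinfun)
      + (\<Sum>b\<in>B. (coeff P i * (l b ^ i - 0 ^ i)) *\<^sub>R rk b b))"
    unfolding op_poly_def pow by (simp add: scaleR_add_right scaleR_sum_right diag_op_def)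
  also have "\<dots> = (\<Sum>i\<le>degree P. coeff P i * 0 ^ i) *\<^sub>R id_blinfun
      + (\<Sum>b\<in>B. (\<Sum>i\<le>degree P. coeff P i * (l b ^ i - 0 ^ i)) *\<^sub>R rk b b)"
    unfolding sum.distrib scaleR_sum_left scaleR_scaleR
    by (rule arg_cong2[where f = plus, OF refl sum.swap])
  finally show ?thesis
    by (simp add: poly_altdef diag_op_def right_diff_distrib sum_subtractf)
qed

text \<open>Eigenvalues lie in the interval of uniform convergence, so the coefficients in
  \<open>op_poly_diag_op\<close> converge; the multiple of the identity disappears in the limit
  because \<open>0 powr s = 0\<close>.\<close>

lemma op_powr_diag_op:
  assumes B: "orthonormal B" and l: "\<And>b. b \<in> B \<Longrightarrow> 0 \<le> l b" and s: "s > 0"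
  shows "op_powr (diag_op B l) s = diag_op B (\<lambda>b. l b powr s)"
  unfolding op_powr_def
proof (rule the_equality)
  let ?R = "diag_op B l"
  show lim: "\<forall>P. uniform_limit {0..norm ?R} (\<lambda>n. poly (P n)) (\<lambda>t. t powr s) sequentially
    \<longrightarrow> (\<lambda>n. op_poly (P n) ?R) \<longlonglongrightarrow> diag_op B (\<lambda>b. l b powr s)"
  proof (intro allI impI)
    fix P :: "nat \<Rightarrow> real poly"
    assume "uniform_limit {0..norm ?R} (\<lambda>n. poly (P n)) (\<lambda>t. t powr s) sequentially"
    then have P: "(\<lambda>n. poly (P n) t) \<longlonglongrightarrow> t powr s" if "t \<in> {0..norm ?R}" for t
      using that by (rule tendsto_uniform_limitI)
    have "l b \<in> {0..norm ?R}" if "b \<in> B" for b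
      using l[OF that] abs_eigenvalue_le_norm[OF B that, of l] by simp
    then have "(\<lambda>n. poly (P n) 0 *\<^sub>R id_blinfun + (\<Sum>b\<in>B. (poly (P n) (l b) - poly (P n) 0) *\<^sub>R rk b b))
      \<longlonglongrightarrow> (0 powr s) *\<^sub>R id_blinfun + (\<Sum>b\<in>B. (l b powr s - 0 powr s) *\<^sub>R rk b b)"
      by (intro tendsto_intros P) auto
    then show "(\<lambda>n. op_poly (P n) ?R) \<longlonglongrightarrow> diag_op B (\<lambda>b. l b powr s)"
      by (simp add: op_poly_diag_op[OF B]) (simp add: diag_op_def)
  qed
  fix y :: op
  assume y: "\<forall>P. uniform_limit {0..norm ?R} (\<lambda>n. poly (P n)) (\<lambda>t. t powr s) sequentially
    \<longrightarrow> (\<lambda>n. op_poly (P n) ?R) \<longlonglongrightarrow> y"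
  have "continuous_on {0..norm ?R} (\<lambda>t. t powr s)"
    using s by (intro continuous_on_powr' continuous_intros) auto
  then obtain P where
    "uniform_limit {0..norm ?R} (\<lambda>n. poly (P n)) (\<lambda>t. t powr s) sequentially"
    by (rule exists_poly_uniform_limit)
  then show "y = diag_op B (\<lambda>b. l b powr s)"
    using y lim LIMSEQ_unique by blast
qed

text \<open>Exchange the two sums; for each unit vector \<open>b\<close> the squared moduli of its
  coordinates add up to 1.\<close>

lemma op_trace_diag_op:
  assumes B: "orthonormal B" and l: "\<And>b. b \<in> B \<Longrightarrow> 0 \<le> l b"
  shows "op_trace (diag_op B l) = ennreal (sum l B)"
proof -
  have "ell2_cinner (ket k) (l b *\<^sub>R rk b b (ket k)) = of_real (l b * (cmod (coord b k))\<^sup>2)" for b k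
    by (simp add: cinner_scaleR_right rk.rep_eq cinner_scaleC_right cinner_ket_left cinner_ket_right
        complex_norm_square mult.commute del: of_real_power)
  then have "Re (ell2_cinner (ket k) (diag_op B l (ket k))) = (\<Sum>b\<in>B. l b * (cmod (coord b k))\<^sup>2)" for k
    by (simp add: diag_op_apply cinner_sum_right)
  moreover have "(\<lambda>k. \<Sum>b\<in>B. l b * (cmod (coord b k))\<^sup>2) sums (\<Sum>b\<in>B. l b * (norm b)\<^sup>2)"
    by (intro sums_sum sums_mult norm_sq_sums)
  moreover have "(\<Sum>b\<in>B. l b * (norm b)\<^sup>2) = sum l B"
    using orthonormal_norm[OF B] by (intro sum.cong) auto
  ultimately show ?thesis
    unfolding op_trace_def using l by (simp add: suminf_ennreal_eq sum_nonneg sums_iff)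
qed

lemma schatten_norm_diag_op:
  assumes B: "orthonormal B" and l: "\<And>b. b \<in> B \<Longrightarrow> 0 \<le> l b" and p: "p > 0"
  shows "schatten_norm p (diag_op B l) = (\<Sum>b\<in>B. l b powr p) powr (1/p)"
proof -
  have "op_powr (diag_op B (\<lambda>b. l b * l b)) (p/2) = diag_op B (\<lambda>b. (l b * l b) powr (p/2))"
    using l p by (intro op_powr_diag_op B) auto
  also have "\<dots> = diag_op B (\<lambda>b. l b powr p)"
    using l by (intro diag_op_cong) (simp add: powr_mult flip: powr_add)
  finally show ?thesis
    unfolding schatten_norm_def adj_diag_op diag_op_comp[OF B]
    by (simp add: op_trace_diag_op[OF B] sum_nonneg)
qed

lemma scaled_rk_eq_diag_op:
  assumes "c \<ge> 0"
  obtains w l where "orthonormal {w}" "l \<ge> 0" "c *\<^sub>R rk v v = diag_op {w} (\<lambda>_. l)"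
proof -
  obtain w where w: "norm w = 1" "v = norm v *\<^sub>R w"
  proof (cases "v = 0")
    \<comment> \<open>For the zero vector any unit vector will do, the eigenvalue being 0.\<close>
    case True then show ?thesis using that[of "ket 0"] by (simp add: norm_ket)
  next
    case False then show ?thesis using that[of "sgn v"] by (simp add: norm_sgn sgn_div_norm)
  qed
  have "orthonormal {w}" using w(1) by (simp add: orthonormal_def cinner_self)
  moreover have "c *\<^sub>R rk v v = diag_op {w} (\<lambda>_. c * (norm v)\<^sup>2)"
    by (subst (1 2) w(2)) (simp add: rk_scaleR_left rk_scaleR_right diag_op_def power2_eq_square)
  ultimately show ?thesis using assms by (intro that[of w "c * (norm v)\<^sup>2"]) simp_all
qed

section \<open>Moduli and finite column norms of rank-one operators\<close>

lemma rk_in_schatten: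
  assumes "p > 0"
  shows "rk u v \<in> schatten p"
proof -
  have "adj (rk u v) o\<^sub>L rk u v = (norm u)\<^sup>2 *\<^sub>R rk v v"
    by (simp add: adj_rk rk_comp_rk)
  moreover obtain w l where "orthonormal {w}" "l \<ge> 0" "(norm u)\<^sup>2 *\<^sub>R rk v v = diag_op {w} (\<lambda>_. l)"
    by (rule scaled_rk_eq_diag_op[OF zero_le_power2])
  ultimately show ?thesis using assms
    by (simp add: schatten_def complex_linear_rk compact_op_rk op_powr_diag_op op_trace_diag_op)
qed

text \<open>The square of the modulus is the adjoint times the operator. This must be proved, since
  \<open>op_abs\<close> is a root taken through \<open>op_powr\<close>; here the operator under the
  root has a single eigenvector direction.\<close>

lemma op_abs_rk_sq: "op_abs (rk u v) o\<^sub>L op_abs (rk u v) = (norm u)\<^sup>2 *\<^sub>R rk v v"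
proof -
  have "adj (rk u v) o\<^sub>L rk u v = (norm u)\<^sup>2 *\<^sub>R rk v v"
    by (simp add: adj_rk rk_comp_rk)
  moreover obtain w l where w: "orthonormal {w}" "l \<ge> 0" "(norm u)\<^sup>2 *\<^sub>R rk v v = diag_op {w} (\<lambda>_. l)"
    by (rule scaled_rk_eq_diag_op[OF zero_le_power2])
  ultimately show ?thesis
    by (simp add: op_abs_def op_powr_diag_op diag_op_comp flip: powr_add)
qed

lemma fin_row_norm_eq: "fin_row_norm p I x = fin_col_norm p I (\<lambda>k. adj (x k))"
  by (simp add: fin_row_norm_def fin_col_norm_def)

lemma fin_col_norm_eq_of_diag_op:
  assumes "(\<Sum>k\<in>I. op_abs (x k) o\<^sub>L op_abs (x k)) = diag_op B l"
    and B: "orthonormal B" and l: "\<And>b. b \<in> B \<Longrightarrow> 0 \<le> l b" and p: "p > 0"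
  shows "fin_col_norm p I x = (\<Sum>b\<in>B. l b powr (p/2)) powr (1/p)"
  unfolding fin_col_norm_def assms(1)
  by (simp add: op_powr_diag_op B l schatten_norm_diag_op p powr_powr)

text \<open>All squared moduli are multiples of the one projection \<open>rk e e\<close>, so a
  single eigenvalue remains and the norm does not depend on \<open>p\<close>.\<close>

lemma fin_col_norm_rk_fixed_right:
  assumes "norm e = 1" "p > 0"
  shows "fin_col_norm p I (\<lambda>k. rk (u k) e) = sqrt (\<Sum>k\<in>I. (norm (u k))\<^sup>2)"
proof -
  let ?t = "\<Sum>k\<in>I. (norm (u k))\<^sup>2"
  have "(\<Sum>k\<in>I. op_abs (rk (u k) e) o\<^sub>L op_abs (rk (u k) e)) = diag_op {e} (\<lambda>_. ?t)"
    by (simp add: op_abs_rk_sq diag_op_def scaleR_sum_left)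
  moreover have "orthonormal {e}" using assms by (simp add: orthonormal_def cinner_self)
  ultimately have "fin_col_norm p I (\<lambda>k. rk (u k) e) = (\<Sum>b\<in>{e}. ?t powr (p/2)) powr (1/p)"
    using assms by (intro fin_col_norm_eq_of_diag_op) (auto intro: sum_nonneg)
  then show ?thesis using assms by (simp add: powr_powr powr_half_sqrt sum_nonneg)
qed

section \<open>Spectral theorem and monotonicity of traces\<close>

text \<open>First variation: the form \<open>G\<close> is nonnegative on \<open>T\<close> and
  vanishes at \<open>v\<close>, so \<open>G v h = 0\<close> for every direction in \<open>T\<close>.
  The direction \<open>h = m *\<^sub>R v - f v\<close> gives
  \<open>G v h = inner h h\<close>.\<close>

lemma quadratic_maximizer_is_eigenvector:
  fixes f :: "'a::real_inner \<Rightarrow> 'a"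
  assumes f: "linear f" "\<And>x y. inner (f x) y = inner x (f y)"
    and T: "subspace T" "\<And>x. x \<in> T \<Longrightarrow> f x \<in> T"
    and v: "v \<in> T" "norm v = 1" "\<And>w. w \<in> T \<Longrightarrow> norm w = 1 \<Longrightarrow> inner (f w) w \<le> inner (f v) v"
  shows "f v = inner (f v) v *\<^sub>R v"
proof -
  define m where "m = inner (f v) v"
  define h where "h = m *\<^sub>R v - f v"
  define G where "G = (\<lambda>x y. m * inner x y - inner (f x) y)"
  have G_nonneg: "0 \<le> G w w" if "w \<in> T" for w
  proof (cases "w = 0")
    case False
    have "sgn w \<in> T" using T that by (simp add: sgn_div_norm subspace_scale)
    then have "inner (f (sgn w)) (sgn w) \<le> m"
      using v(3) False by (simp add: m_def norm_sgn)
    then have "inner (f w) w / (norm w)\<^sup>2 \<le> m"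
      using f(1) by (simp add: sgn_div_norm linear_scale power2_eq_square divide_inverse mult_ac)
    then show ?thesis using False by (simp add: G_def pos_divide_le_eq power2_norm_eq_inner)
  qed (simp add: G_def)
  have hT: "h \<in> T" unfolding h_def using T v by (intro subspace_diff subspace_scale) auto
  have quad: "0 \<le> 2 * t * G v h + t\<^sup>2 * G h h" for t
  proof -
    have "0 \<le> G (v + t *\<^sub>R h) (v + t *\<^sub>R h)"
      using T hT v by (intro G_nonneg subspace_add subspace_scale) auto
    also have "\<dots> = G v v + 2 * t * G v h + t\<^sup>2 * G h h"
      using f(1) f(2)[of h v]
      by (simp add: G_def linear_add linear_scale inner_add_left inner_add_right algebra_simps
          power2_eq_square inner_commute)
    also have "G v v = 0" using v(2) by (simp add: G_def m_def norm_eq_1)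
    finally show ?thesis by simp
  qed
  have "G v h = 0"
  proof (rule ccontr)
    assume "G v h \<noteq> 0"
    define g where "g = \<bar>G v h\<bar>"
    define r where "r = g / (\<bar>G h h\<bar> + 1)"
    \<comment> \<open>The sign makes the linear term equal to -2 r g, and \<open>r\<close> is so
      small that the quadratic term is at most r g.\<close>
    define t where "t = - sgn (G v h) * r"
    have g: "g > 0" using \<open>G v h \<noteq> 0\<close> by (simp add: g_def)
    have r: "r > 0" using g by (simp add: r_def)
    have "0 \<le> 2 * t * G v h + t\<^sup>2 * G h h" by (rule quad)
    also have "2 * t * G v h = - 2 * r * g"
      by (simp add: t_def g_def sgn_if)
    also have "t\<^sup>2 = r\<^sup>2" using \<open>G v h \<noteq> 0\<close> by (simp add: t_def power_mult_distrib sgn_if power2_eq_square)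
    also have "r\<^sup>2 * G h h \<le> r * g"
    proof -
      have "r * G h h \<le> r * (\<bar>G h h\<bar> + 1)" using r by (intro mult_left_mono) auto
      also have "\<dots> = g" by (simp add: r_def add_pos_nonneg add_nonneg_eq_0_iff)
      finally show ?thesis using r mult_left_mono[of "r * G h h" g r]
        by (simp add: power2_eq_square mult.assoc)
    qed
    finally have "r * g \<le> 0" by (simp add: mult.commute)
    then show False using mult_pos_pos[OF r g] by simp
  qed
  moreover have "G v h = inner h h"
    by (simp add: G_def h_def algebra_simps)
  ultimately show ?thesis by (simp add: h_def m_def)
qed

text \<open>Take an orthonormal set of eigenvectors in \<open>S\<close> of maximal cardinality;
  \<open>K\<close> bounds that cardinality. Its complement \<open>T\<close> in \<open>S\<close> is
  invariant as \<open>f\<close> is symmetric. Were \<open>T\<close> nonzero, the quadratic form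
  would attain its maximum on the compact unit sphere of \<open>T\<close>, at a further
  eigenvector.\<close>

lemma exists_orthonormal_eigenbasis:
  fixes f :: "'a::real_inner \<Rightarrow> 'a"
  assumes f: "linear f" "\<And>x y. inner (f x) y = inner x (f y)" "continuous_on UNIV f"
    and S: "subspace S" "\<And>x. x \<in> S \<Longrightarrow> f x \<in> S" "compact {x\<in>S. norm x = 1}"
    and K: "finite K" "S \<subseteq> span K"
  obtains B where "finite B" "B \<subseteq> S" "\<And>b c. b \<in> B \<Longrightarrow> c \<in> B \<Longrightarrow> inner b c = (if b = c then 1 else 0)"
    "\<And>b. b \<in> B \<Longrightarrow> f b = inner (f b) b *\<^sub>R b"
    "\<And>x. x \<in> S \<Longrightarrow> x = (\<Sum>b\<in>B. inner b x *\<^sub>R b)"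
proof -
  define good where "good = (\<lambda>B. finite B \<and> B \<subseteq> S \<and> (\<forall>b\<in>B. \<forall>c\<in>B. inner b c = (if b = c then 1 else 0))
    \<and> (\<forall>b\<in>B. f b = inner (f b) b *\<^sub>R b))"
  have card_le: "card B \<le> card K" if "good B" for B
  proof -
    have "pairwise orthogonal B" "0 \<notin> B"
      using that by (auto simp: good_def pairwise_def orthogonal_def) (metis inner_zero_left zero_neq_one)
    then have "independent B" by (rule pairwise_orthogonal_independent)
    moreover have "B \<subseteq> span K" using that K by (auto simp: good_def)
    ultimately show ?thesis using independent_span_bound[OF K(1)] by blast
  qed
  have "good {}" by (simp add: good_def)
  then obtain B where B: "good B" and max: "\<And>B'. good B' \<Longrightarrow> card B' \<le> card B"
    using ex_has_greatest_nat[of good "{}" card "Suc (card K)"] card_le le_imp_less_Suc by metis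
  define T where "T = {x\<in>S. \<forall>b\<in>B. inner b x = 0}"
  have T: "subspace T"
    using S(1) by (auto simp: T_def subspace_def inner_add_right)
  have fT: "f x \<in> T" if "x \<in> T" for x
  proof -
    have "inner b (f x) = 0" if "b \<in> B" for b
    proof -
      have "inner b (f x) = inner (f b) x" by (simp add: f(2))
      also have "\<dots> = inner (f b) b * inner b x"
        using B that by (metis good_def inner_scaleR_left)
      finally show ?thesis using \<open>x \<in> T\<close> that by (simp add: T_def)
    qed
    then show ?thesis using S(2) that by (auto simp: T_def)
  qed
  have T0: "x = 0" if "x \<in> T" for x
  proof (rule ccontr)
    assume "x \<noteq> 0"
    let ?C = "{x\<in>S. norm x = 1} \<inter> (\<Inter>b\<in>B. {x. inner b x = 0})"
    have C: "?C = {x\<in>T. norm x = 1}" by (auto simp: T_def)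
    have "compact ?C" by (intro compact_Int_closed S(3) closed_INT ballI closed_hyperplane)
    moreover have "sgn x \<in> ?C" unfolding C using T that \<open>x \<noteq> 0\<close>
      by (simp add: norm_sgn sgn_div_norm subspace_scale)
    moreover have "continuous_on ?C (\<lambda>w. inner (f w) w)"
      by (intro continuous_intros continuous_on_subset[OF f(3)]) auto
    ultimately obtain v where v: "v \<in> ?C" "\<And>w. w \<in> ?C \<Longrightarrow> inner (f w) w \<le> inner (f v) v"
      using continuous_attains_sup[of ?C "\<lambda>w. inner (f w) w"] by blast
    have vT: "v \<in> T" "norm v = 1" using v(1) unfolding C by auto
    have "f v = inner (f v) v *\<^sub>R v"
      by (rule quadratic_maximizer_is_eigenvector[OF f(1,2) T fT vT]) (use v(2) C in auto)
    then have "good (insert v B)"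
      using B vT unfolding good_def T_def by (auto simp: norm_eq_1 inner_commute)
    moreover have "v \<notin> B" using vT B by (force simp: T_def good_def norm_eq_1)
    ultimately show False using max[of "insert v B"] B by (simp add: good_def)
  qed
  have "x = (\<Sum>b\<in>B. inner b x *\<^sub>R b)" if "x \<in> S" for x
  proof -
    have "inner c (\<Sum>b\<in>B. inner b x *\<^sub>R b) = inner c x" if "c \<in> B" for c
    proof -
      have "inner c (\<Sum>b\<in>B. inner b x *\<^sub>R b) = (\<Sum>b\<in>B. if c = b then inner c x else 0)"
        unfolding inner_sum_right using B that by (intro sum.cong) (auto simp: good_def)
      then show ?thesis using B that by (simp add: good_def)
    qed
    moreover have "(\<Sum>b\<in>B. inner b x *\<^sub>R b) \<in> S"
      using B S(1) by (intro subspace_sum subspace_scale) (auto simp: good_def)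
    ultimately have "x - (\<Sum>b\<in>B. inner b x *\<^sub>R b) \<in> T"
      using that S(1) by (auto simp: T_def inner_diff_right subspace_diff)
    then show ?thesis using T0 by fastforce
  qed
  then show ?thesis using B that[of B] by (auto simp: good_def)
qed

section \<open>Eigenbases for sums of rank-one operators with real coordinates\<close>

definition real_span :: "nat \<Rightarrow> ell2 set"
  where "real_span n = span (ket ` {..<n})"

lemma subspace_real_span: "subspace (real_span n)"
  by (simp add: real_span_def)

lemma Im_coord_real_span: "x \<in> real_span n \<Longrightarrow> Im (coord x j) = 0"
  unfolding real_span_def
  by (induction rule: span_induct)
     (auto simp: coord_ket subspace_def coord_simps)

lemma cinner_real_span:
  assumes "x \<in> real_span n" "y \<in> real_span m"
  shows "ell2_cinner x y = of_real (inner x y)"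
proof -
  have "cnj (coord x j) * coord y j = of_real (Re (cnj (coord x j) * coord y j))" for j
    using Im_coord_real_span[OF assms(1)] Im_coord_real_span[OF assms(2)]
    by (simp add: complex_eq_iff)
  then have "(\<lambda>j. of_real (Re (cnj (coord x j) * coord y j))) = (\<lambda>j. cnj (coord x j) * coord y j)"
    by (intro ext) (rule sym)
  then have "(\<lambda>j. cnj (coord x j) * coord y j) sums of_real (inner x y)"
    using sums_of_real[OF inner_ell2_sums[of x y], where ?'a = complex] by simp
  then show ?thesis by (simp add: ell2_cinner_def sums_iff)
qed

lemma inner_ket: "inner (ket i) (ket j) = (if i = j then 1 else 0)"
  by (simp add: Re_cinner[symmetric] cinner_ket_left coord_ket)

lemma real_span_expand:
  assumes "x \<in> real_span n"
  shows "x = (\<Sum>k<n. inner (ket k) x *\<^sub>R ket k)"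
  using assms unfolding real_span_def
proof (induction rule: span_induct)
  case base
  show ?case
  proof (rule subspaceI; unfold mem_Collect_eq)
    fix x y :: ell2 and c :: real
    assume "x = (\<Sum>k<n. inner (ket k) x *\<^sub>R ket k)" "y = (\<Sum>k<n. inner (ket k) y *\<^sub>R ket k)"
    then show "x + y = (\<Sum>k<n. inner (ket k) (x + y) *\<^sub>R ket k)"
      by (simp add: inner_add_right scaleR_add_left sum.distrib)
  next
    fix x :: ell2 and c :: real
    assume "x = (\<Sum>k<n. inner (ket k) x *\<^sub>R ket k)"
    then show "c *\<^sub>R x = (\<Sum>k<n. inner (ket k) (c *\<^sub>R x) *\<^sub>R ket k)"
      by (simp flip: scaleR_scaleR scaleR_sum_right)
  qed simp
next
  case (step x)
  then obtain j where j: "j < n" "x = ket j" by auto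
  then have "(\<Sum>k<n. inner (ket k) x *\<^sub>R ket k) = (\<Sum>k<n. if k = j then ket j else 0)"
    by (intro sum.cong) (auto simp: inner_ket)
  then show ?case using j by simp
qed

text \<open>The combinations with coefficients in [-1, 1] form a finite sum of segments, hence a
  compact set. A unit vector has such coefficients, so the sphere is a closed part of it.\<close>

lemma compact_real_sphere: "compact {x \<in> real_span n. norm x = 1}"
proof -
  define Q where "Q = (\<lambda>n. {(\<Sum>k<n. c k *\<^sub>R ket k) | c. \<forall>k<n. \<bar>c k\<bar> \<le> 1})"
  have Q_Suc: "Q (Suc n) = {x + y | x y. x \<in> Q n \<and> y \<in> (\<lambda>t. t *\<^sub>R ket n) ` {-1..1}}" for n
  proof (intro equalityI subsetI)
    fix z assume "z \<in> Q (Suc n)"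
    then obtain c where c: "z = (\<Sum>k<n. c k *\<^sub>R ket k) + c n *\<^sub>R ket n" "\<forall>k<Suc n. \<bar>c k\<bar> \<le> 1"
      by (auto simp: Q_def)
    then have "(\<Sum>k<n. c k *\<^sub>R ket k) \<in> Q n" unfolding Q_def by auto
    moreover have "\<bar>c n\<bar> \<le> 1" using c(2) by simp
    then have "c n \<in> {-1..1}" by (simp add: abs_le_iff)
    then have "c n *\<^sub>R ket n \<in> (\<lambda>t. t *\<^sub>R ket n) ` {-1..1}" by (rule imageI)
    ultimately show "z \<in> {x + y | x y. x \<in> Q n \<and> y \<in> (\<lambda>t. t *\<^sub>R ket n) ` {-1..1}}"
      using c(1) by blast
  next
    fix z assume "z \<in> {x + y | x y. x \<in> Q n \<and> y \<in> (\<lambda>t. t *\<^sub>R ket n) ` {-1..1}}"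
    then obtain x t where "x \<in> Q n" "\<bar>t\<bar> \<le> 1" "z = x + t *\<^sub>R ket n"
      by (auto simp: abs_le_iff)
    then obtain c where "\<forall>k<n. \<bar>c k\<bar> \<le> 1" "\<bar>t\<bar> \<le> 1" "z = (\<Sum>k<n. c k *\<^sub>R ket k) + t *\<^sub>R ket n"
      unfolding Q_def by blast
    then have "z = (\<Sum>k<Suc n. (c(n := t)) k *\<^sub>R ket k)" "\<forall>k<Suc n. \<bar>(c(n := t)) k\<bar> \<le> 1"
      by (auto simp: less_Suc_eq)
    then show "z \<in> Q (Suc n)" unfolding Q_def by blast
  qed
  have "compact (Q n)" for n
  proof (induction n)
    case 0 then show ?case by (simp add: Q_def)
  next
    case (Suc n)
    then show ?case unfolding Q_Suc
      by (intro compact_sums compact_continuous_image continuous_intros) auto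
  qed
  then have "compact (Q n \<inter> {x. norm x = 1})"
    by (intro compact_Int_closed closed_Collect_eq continuous_intros)
  moreover have "Q n \<inter> {x. norm x = 1} = {x \<in> real_span n. norm x = 1}"
  proof (intro equalityI subsetI)
    fix x assume "x \<in> Q n \<inter> {x. norm x = 1}"
    then show "x \<in> {x \<in> real_span n. norm x = 1}"
      unfolding Q_def real_span_def by (auto intro: span_sum span_scale span_base)
  next
    fix x assume x: "x \<in> {x \<in> real_span n. norm x = 1}"
    have "\<bar>inner (ket k) x\<bar> \<le> 1" for k
      using Cauchy_Schwarz_ineq2[of "ket k" x] x by (simp add: norm_ket)
    then show "x \<in> Q n \<inter> {x. norm x = 1}"
      using x real_span_expand[of x n] unfolding Q_def by auto
  qed
  ultimately show ?thesis by simp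
qed

text \<open>
  Eigenbasis data for \<open>\<Sum>k\<in>I. |u\<^sub>k\<rangle>\<langle>u\<^sub>k|\<close>. As the \<open>u\<^sub>k\<close> have real coordinates, the eigenvectors can be
  taken in the real span of the basis vectors, where the complex inner product is the real one.
\<close>

definition eigenbasis :: "nat \<Rightarrow> nat set \<Rightarrow> (nat \<Rightarrow> ell2) \<Rightarrow> ell2 set \<Rightarrow> (ell2 \<Rightarrow> real) \<Rightarrow> bool"
  where "eigenbasis n I u B l \<longleftrightarrow> orthonormal B \<and> B \<subseteq> real_span n \<and>
    (\<forall>x\<in>real_span n. x = (\<Sum>b\<in>B. inner b x *\<^sub>R b)) \<and>
    (\<forall>b\<in>B. (\<Sum>k\<in>I. inner (u k) b *\<^sub>R u k) = l b *\<^sub>R b)"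

lemma exists_eigenbasis:
  assumes u: "\<And>k. k \<in> I \<Longrightarrow> u k \<in> real_span n"
  obtains B l where "eigenbasis n I u B l"
proof -
  define f where "f = (\<lambda>x. \<Sum>k\<in>I. inner (u k) x *\<^sub>R u k)"
  obtain B where B: "finite B" "B \<subseteq> real_span n"
    "\<And>b c. b \<in> B \<Longrightarrow> c \<in> B \<Longrightarrow> inner b c = (if b = c then 1 else 0)"
    "\<And>b. b \<in> B \<Longrightarrow> f b = inner (f b) b *\<^sub>R b"
    "\<And>x. x \<in> real_span n \<Longrightarrow> x = (\<Sum>b\<in>B. inner b x *\<^sub>R b)"
  proof (rule exists_orthonormal_eigenbasis[of f "real_span n" "ket ` {..<n}"])
    show "linear f"
      by (rule linearI) (simp_all add: f_def inner_add_right scaleR_add_left sum.distrib scaleR_sum_right)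
    show "inner (f x) y = inner x (f y)" for x y
      by (simp add: f_def inner_sum_left inner_sum_right inner_commute mult.commute)
    show "continuous_on UNIV f" unfolding f_def by (intro continuous_intros)
    show "f x \<in> real_span n" for x
      unfolding f_def using u by (intro subspace_sum subspace_scale subspace_real_span)
    show "real_span n \<subseteq> span (ket ` {..<n})" by (simp add: real_span_def)
  qed (simp_all add: subspace_real_span compact_real_sphere that)
  have "orthonormal B"
    unfolding orthonormal_def using B(1,2,3) cinner_real_span[of _ n _ n] by (simp add: subset_iff)
  then have "eigenbasis n I u B (\<lambda>b. inner (f b) b)"
    using B by (auto simp: eigenbasis_def f_def)
  then show ?thesis by (rule that)
qed

context
  fixes n I u B l
  assumes eb: "eigenbasis n I u B l"
begin

lemma eigenbasis_inner: "b \<in> B \<Longrightarrow> c \<in> B \<Longrightarrow> inner b c = (if b = c then 1 else 0)"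
  using eb unfolding eigenbasis_def orthonormal_def
  by (simp add: Re_cinner[symmetric])

text \<open>Both sides are the quadratic form <R x, x> of R, the sum of the operators
  \<open>rk (u k) (u k)\<close>.\<close>

lemma eigenbasis_quadratic:
  assumes "x \<in> real_span n"
  shows "(\<Sum>k\<in>I. (inner (u k) x)\<^sup>2) = (\<Sum>b\<in>B. l b * (inner b x)\<^sup>2)"
proof -
  have "(\<Sum>k\<in>I. (inner (u k) x)\<^sup>2) = (\<Sum>k\<in>I. inner (u k) (\<Sum>b\<in>B. inner b x *\<^sub>R b) * inner (u k) x)"
    using eb assms unfolding eigenbasis_def by (simp add: power2_eq_square)
  also have "\<dots> = (\<Sum>b\<in>B. inner b x * inner (\<Sum>k\<in>I. inner (u k) b *\<^sub>R u k) x)"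
    by (simp add: inner_sum_right inner_sum_left sum_distrib_left sum_distrib_right mult.assoc)
       (rule sum.swap)
  also have "\<dots> = (\<Sum>b\<in>B. l b * (inner b x)\<^sup>2)"
    using eb unfolding eigenbasis_def by (intro sum.cong) (auto simp: power2_eq_square)
  finally show ?thesis .
qed

lemma eigenbasis_eigenvalue:
  assumes "b \<in> B"
  shows "l b = (\<Sum>k\<in>I. (inner (u k) b)\<^sup>2)"
proof -
  have "b \<in> real_span n" "finite B"
    using assms eb by (auto simp: eigenbasis_def orthonormal_def)
  then have "(\<Sum>k\<in>I. (inner (u k) b)\<^sup>2) = (\<Sum>c\<in>B. l c * (inner c b)\<^sup>2)"
    by (simp add: eigenbasis_quadratic)
  also have "\<dots> = (\<Sum>c\<in>B. if c = b then l b else 0)"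
    using assms by (intro sum.cong) (auto simp: eigenbasis_inner)
  finally show ?thesis using assms \<open>finite B\<close> by simp
qed

lemma eigenbasis_parseval:
  assumes "x \<in> real_span n"
  shows "(\<Sum>b\<in>B. (inner b x)\<^sup>2) = (norm x)\<^sup>2"
proof -
  have "(norm x)\<^sup>2 = inner (\<Sum>b\<in>B. inner b x *\<^sub>R b) x"
    using eb assms unfolding eigenbasis_def by (simp add: power2_norm_eq_inner)
  then show ?thesis by (simp add: inner_sum_left power2_eq_square)
qed

text \<open>The two expressions for the trace of R, by Parseval for each \<open>u k\<close>.\<close>

lemma sum_eigenvalues:
  assumes "\<And>k. k \<in> I \<Longrightarrow> u k \<in> real_span n"
  shows "sum l B = (\<Sum>k\<in>I. (norm (u k))\<^sup>2)"
proof -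
  have "sum l B = (\<Sum>b\<in>B. \<Sum>k\<in>I. (inner b (u k))\<^sup>2)"
    by (simp add: eigenbasis_eigenvalue inner_commute cong: sum.cong)
  also have "\<dots> = (\<Sum>k\<in>I. \<Sum>b\<in>B. (inner b (u k))\<^sup>2)" by (rule sum.swap)
  finally show ?thesis using assms by (simp add: eigenbasis_parseval)
qed

lemma sum_rk_eq_diag_op:
  assumes "\<And>k. k \<in> I \<Longrightarrow> u k \<in> real_span n"
  shows "(\<Sum>k\<in>I. rk (u k) (u k)) = diag_op B l"
proof -
  have "(\<Sum>k\<in>I. rk (u k) (u k)) = (\<Sum>k\<in>I. rk (u k) (\<Sum>b\<in>B. inner b (u k) *\<^sub>R b))"
    using eb assms unfolding eigenbasis_def by (intro sum.cong) auto
  also have "\<dots> = (\<Sum>b\<in>B. rk (\<Sum>k\<in>I. inner (u k) b *\<^sub>R u k) b)"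
    by (simp add: rk_sum_left rk_sum_right rk_scaleR_left rk_scaleR_right inner_commute)
       (rule sum.swap)
  also have "\<dots> = diag_op B l"
    unfolding diag_op_def using eb by (intro sum.cong) (auto simp: eigenbasis_def rk_scaleR_left)
  finally show ?thesis .
qed

lemma card_eigenbasis: "card B \<le> n"
proof -
  have "finite B" "B \<subseteq> span (ket ` {..<n})"
    using eb by (auto simp: eigenbasis_def real_span_def orthonormal_def)
  moreover have "independent B"
    by (rule pairwise_orthogonal_independent)
       (use eigenbasis_inner in \<open>force simp: pairwise_def orthogonal_def\<close>)+
  ultimately have "card B \<le> card (ket ` {..<n})"
    using independent_span_bound[of "ket ` {..<n}" B] by blast
  also have "\<dots> \<le> n" using card_image_le[of "{..<n}" ket] by simp
  finally show ?thesis .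
qed

end

section \<open>Jensen's inequality for powers\<close>

lemma powr_le_tangent:
  fixes t :: real
  assumes "0 < s" "s \<le> 1" "0 \<le> t"
  shows "t powr s \<le> 1 + s * (t - 1)"
proof (cases "t = 0")
  case False
  then show ?thesis
    using Youngs_inequality_0[of s "1 - s" t 1] assms by (simp add: algebra_simps)
qed (use assms in simp)

text \<open>The concave tangent bound, used with exponent 1/s at the point t^s.\<close>

lemma powr_ge_tangent:
  fixes t :: real
  assumes "1 \<le> s" "0 \<le> t"
  shows "1 + s * (t - 1) \<le> t powr s"
proof -
  have "(t powr s) powr (1/s) \<le> 1 + 1/s * (t powr s - 1)"
    using assms by (intro powr_le_tangent) auto
  then show ?thesis using assms by (simp add: powr_powr field_simps)
qed

text \<open>Average the tangent-line bound at 1 over the values t_i / m, where m is the weighted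
  mean: the linear terms cancel.\<close>

lemma powr_jensen_convex:
  fixes t :: "'i \<Rightarrow> real"
  assumes "1 \<le> s" "\<And>i. i \<in> A \<Longrightarrow> 0 \<le> w i" "sum w A = 1" "\<And>i. i \<in> A \<Longrightarrow> 0 \<le> t i"
  shows "(\<Sum>i\<in>A. w i * t i) powr s \<le> (\<Sum>i\<in>A. w i * t i powr s)"
proof -
  define m where "m = (\<Sum>i\<in>A. w i * t i)"
  have "0 \<le> m" unfolding m_def using assms by (intro sum_nonneg) auto
  show ?thesis
  proof (cases "m = 0")
    case True
    then show ?thesis using assms by (simp add: m_def sum_nonneg)
  next
    case False
    with \<open>0 \<le> m\<close> have "m > 0" by simp
    have "1 = (\<Sum>i\<in>A. w i) + s * ((\<Sum>i\<in>A. w i * t i) / m - (\<Sum>i\<in>A. w i))"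
      using False assms by (simp add: m_def)
    also have "\<dots> = (\<Sum>i\<in>A. w i * (1 + s * (t i / m - 1)))"
      by (simp add: algebra_simps sum.distrib sum_subtractf sum_distrib_left sum_divide_distrib)
    also have "\<dots> \<le> (\<Sum>i\<in>A. w i * (t i / m) powr s)"
      using assms \<open>m > 0\<close> by (intro sum_mono mult_left_mono powr_ge_tangent) auto
    also have "\<dots> = (\<Sum>i\<in>A. w i * t i powr s) / m powr s"
      using assms \<open>m > 0\<close> by (simp add: powr_divide sum_divide_distrib)
    finally show ?thesis using \<open>m > 0\<close> by (simp add: pos_le_divide_eq m_def)
  qed
qed

lemma powr_jensen_concave:
  fixes t :: "'i \<Rightarrow> real"
  assumes "0 < s" "s \<le> 1" "\<And>i. i \<in> A \<Longrightarrow> 0 \<le> w i" "sum w A = 1" "\<And>i. i \<in> A \<Longrightarrow> 0 \<le> t i"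
  shows "(\<Sum>i\<in>A. w i * t i powr s) \<le> (\<Sum>i\<in>A. w i * t i) powr s"
proof -
  have "finite A" using assms(4) by (metis sum.infinite zero_neq_one)
  define m where "m = (\<Sum>i\<in>A. w i * t i)"
  have "0 \<le> m" unfolding m_def using assms by (intro sum_nonneg) auto
  show ?thesis
  proof (cases "m = 0")
    case True
    then have "\<forall>i\<in>A. w i * t i = 0"
      using assms \<open>finite A\<close> unfolding m_def by (subst (asm) sum_nonneg_eq_0_iff) auto
    then have "(\<Sum>i\<in>A. w i * t i powr s) = 0" by (intro sum.neutral) auto
    then show ?thesis by simp
  next
    case False
    with \<open>0 \<le> m\<close> have "m > 0" by simp
    have "(\<Sum>i\<in>A. w i * t i powr s) / m powr s = (\<Sum>i\<in>A. w i * (t i / m) powr s)"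
      using assms \<open>m > 0\<close> by (simp add: powr_divide sum_divide_distrib)
    also have "\<dots> \<le> (\<Sum>i\<in>A. w i * (1 + s * (t i / m - 1)))"
      using assms \<open>m > 0\<close> by (intro sum_mono mult_left_mono powr_le_tangent) auto
    also have "\<dots> = (\<Sum>i\<in>A. w i) + s * ((\<Sum>i\<in>A. w i * t i) / m - (\<Sum>i\<in>A. w i))"
      by (simp add: algebra_simps sum.distrib sum_subtractf sum_distrib_left sum_divide_distrib)
    also have "\<dots> = 1"
      using False assms by (simp add: m_def)
    finally show ?thesis using \<open>m > 0\<close> by (simp add: pos_divide_le_eq m_def)
  qed
qed

text \<open>
  Jensen's inequality applied to the matrix \<open>(inner c b)\<^sup>2\<close> relating the two eigenbases, which is
  doubly stochastic.
\<close>

lemma sum_powr_eigenvalues_mono: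
  assumes eb: "eigenbasis n I u B l" "eigenbasis n J u B' l'" and IJ: "I \<subseteq> J" "finite J" and s: "0 < s"
  shows "(\<Sum>b\<in>B. l b powr s) \<le> (\<Sum>b\<in>B'. l' b powr s)"
proof -
  have fin: "finite B" "finite B'" and span: "B \<subseteq> real_span n" "B' \<subseteq> real_span n"
    and on: "orthonormal B" "orthonormal B'"
    using eb by (auto simp: eigenbasis_def orthonormal_def)
  have pars: "(\<Sum>c\<in>B'. (inner c b)\<^sup>2) = 1" if "b \<in> B" for b
    using eigenbasis_parseval[OF eb(2)] span that orthonormal_norm[OF on(1) that] by (simp add: subset_iff)
  have pars': "(\<Sum>b\<in>B. (inner c b)\<^sup>2) = 1" if "c \<in> B'" for c
    using eigenbasis_parseval[OF eb(1), of c] span that orthonormal_norm[OF on(2) that]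
    unfolding inner_commute[of c] by auto
  have nonneg: "0 \<le> l b" if "b \<in> B" for b
    using eigenbasis_eigenvalue[OF eb(1) that] by (simp add: sum_nonneg)
  have nonneg': "0 \<le> l' b" if "b \<in> B'" for b
    using eigenbasis_eigenvalue[OF eb(2) that] by (simp add: sum_nonneg)
  have mono: "(\<Sum>k\<in>I. (inner (u k) x)\<^sup>2) \<le> (\<Sum>k\<in>J. (inner (u k) x)\<^sup>2)" for x
    using IJ by (intro sum_mono2) auto
  show ?thesis
  proof (cases "s \<ge> 1")
    \<comment> \<open>Convex case: each \<open>l b\<close> is at most an average of the
      \<open>l' c\<close>. Jensen is applied for fixed \<open>b\<close>, and the sum over
      \<open>b\<close> uses the other normalisation of the matrix.\<close>
    case True
    have "(\<Sum>b\<in>B. l b powr s) \<le> (\<Sum>b\<in>B. \<Sum>c\<in>B'. (inner c b)\<^sup>2 * l' c powr s)"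
    proof (rule sum_mono)
      fix b assume b: "b \<in> B"
      have "l b \<le> (\<Sum>k\<in>J. (inner (u k) b)\<^sup>2)"
        using eigenbasis_eigenvalue[OF eb(1) b] mono by simp
      also have "\<dots> = (\<Sum>c\<in>B'. (inner c b)\<^sup>2 * l' c)"
        using eigenbasis_quadratic[OF eb(2)] span b by (simp add: subset_iff mult.commute)
      finally have "l b powr s \<le> \<dots> powr s" using nonneg[OF b] s by (intro powr_mono2) auto
      also have "\<dots> \<le> (\<Sum>c\<in>B'. (inner c b)\<^sup>2 * l' c powr s)"
        using True fin pars[OF b] nonneg' by (intro powr_jensen_convex) auto
      finally show "l b powr s \<le> (\<Sum>c\<in>B'. (inner c b)\<^sup>2 * l' c powr s)" .
    qed
    also have "\<dots> = (\<Sum>c\<in>B'. (\<Sum>b\<in>B. (inner c b)\<^sup>2) * l' c powr s)"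
      by (subst sum.swap) (simp add: sum_distrib_right)
    finally show ?thesis by (simp add: pars')
  next
    \<comment> \<open>Concave case: the roles are exchanged. Weights of sum 1 are inserted first,
      and Jensen is applied for fixed \<open>c\<close> to the averages of the
      \<open>l b\<close>.\<close>
    case False
    have "(\<Sum>b\<in>B. l b powr s) = (\<Sum>b\<in>B. (\<Sum>c\<in>B'. (inner c b)\<^sup>2) * l b powr s)"
      by (simp add: pars)
    also have "\<dots> = (\<Sum>c\<in>B'. \<Sum>b\<in>B. (inner c b)\<^sup>2 * l b powr s)"
      unfolding sum_distrib_right by (rule sum.swap)
    also have "\<dots> \<le> (\<Sum>c\<in>B'. l' c powr s)"
    proof (rule sum_mono)
      fix c assume c: "c \<in> B'"
      have "(\<Sum>b\<in>B. (inner c b)\<^sup>2 * l b powr s) \<le> (\<Sum>b\<in>B. (inner c b)\<^sup>2 * l b) powr s"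
        using False s fin pars'[OF c] nonneg by (intro powr_jensen_concave) auto
      also have "(\<Sum>b\<in>B. (inner c b)\<^sup>2 * l b) = (\<Sum>k\<in>I. (inner (u k) c)\<^sup>2)"
        using eigenbasis_quadratic[OF eb(1)] span c by (simp add: subset_iff mult.commute inner_commute)
      also have "\<dots> powr s \<le> (\<Sum>k\<in>J. (inner (u k) c)\<^sup>2) powr s"
        using s by (intro powr_mono2 mono sum_nonneg) auto
      also have "\<dots> = l' c powr s" using eigenbasis_eigenvalue[OF eb(2) c] by simp
      finally show "(\<Sum>b\<in>B. (inner c b)\<^sup>2 * l b powr s) \<le> l' c powr s" .
    qed
    finally show ?thesis .
  qed
qed

section \<open>Column and row norms of rank-one sequences\<close>

lemma seq_norm_cong:
  assumes "\<And>k. x k \<in> schatten p" "\<And>I. N I x = g I"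
  shows "seq_norm p N x = (if \<forall>e>0. \<exists>M. \<forall>m\<ge>M. \<forall>n\<ge>m. g {m..<n} < e
    then ennreal (lim (\<lambda>n. g {..<n})) else \<infinity>)"
  using assms by (simp add: seq_norm_def)

lemma seq_norm_l2:
  assumes "\<And>k. x k \<in> schatten p" "\<And>I. N I x = sqrt (\<Sum>k\<in>I. (norm (u k))\<^sup>2)"
    and "summable (\<lambda>k. (norm (u k))\<^sup>2)"
  shows "seq_norm p N x = ennreal (sqrt (\<Sum>k. (norm (u k))\<^sup>2))"
proof -
  let ?g = "\<lambda>I. sqrt (\<Sum>k\<in>I. (norm (u k))\<^sup>2)"
  have "\<exists>M. \<forall>m\<ge>M. \<forall>n\<ge>m. ?g {m..<n} < e" if "e > 0" for e
  proof -
    have "e\<^sup>2 > 0" using that by simp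
    then obtain M where "\<forall>m\<ge>M. \<forall>n. norm (\<Sum>k=m..<n. (norm (u k))\<^sup>2) < e\<^sup>2"
      using assms(3) unfolding summable_Cauchy by blast
    then have "\<forall>m\<ge>M. \<forall>n\<ge>m. ?g {m..<n} < e"
      using that by (auto intro!: real_less_lsqrt simp: sum_nonneg)
    then show ?thesis ..
  qed
  moreover have "lim (\<lambda>n. ?g {..<n}) = sqrt (\<Sum>k. (norm (u k))\<^sup>2)"
    by (intro limI tendsto_real_sqrt summable_LIMSEQ assms(3))
  ultimately show ?thesis
    by (subst seq_norm_cong[where g = ?g and N = N and x = x, OF assms(1,2)]) auto
qed

lemma col_norm_rk_fixed_right:
  assumes "norm e = 1" "p > 0" "summable (\<lambda>k. (norm (u k))\<^sup>2)"
  shows "col_norm p (\<lambda>k. rk (u k) e) = ennreal (sqrt (\<Sum>k. (norm (u k))\<^sup>2))"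
  unfolding col_norm_def using assms
  by (intro seq_norm_l2 rk_in_schatten fin_col_norm_rk_fixed_right)

lemma row_norm_rk_fixed_left:
  assumes "norm e = 1" "p > 0" "summable (\<lambda>k. (norm (u k))\<^sup>2)"
  shows "row_norm p (\<lambda>k. rk e (u k)) = ennreal (sqrt (\<Sum>k. (norm (u k))\<^sup>2))"
  unfolding row_norm_def using assms
  by (intro seq_norm_l2 rk_in_schatten) (simp_all add: fin_row_norm_eq adj_rk fin_col_norm_rk_fixed_right)

text \<open>Lets left and right multiplication share a single hard quantity, the column norm of
  \<open>rk e (u k)\<close>.\<close>

lemma row_norm_eq_col_norm_adj:
  assumes "p > 0"
  shows "row_norm p (\<lambda>k. rk (u k) e) = col_norm p (\<lambda>k. rk e (u k))"
  using assms by (simp add: row_norm_def col_norm_def seq_norm_def rk_in_schatten fin_row_norm_eq adj_rk)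

text \<open>Now the squared moduli are \<open>rk (u k) (u k)\<close>, with varying directions, so
  the whole spectrum of their sum enters. The exponent is p/2 because the norm is taken of the
  square root.\<close>

lemma fin_col_norm_rk_fixed_left:
  assumes "norm e = 1" "p > 0" "\<And>k. k \<in> I \<Longrightarrow> u k \<in> real_span n"
  obtains B l where "eigenbasis n I u B l"
    "fin_col_norm p I (\<lambda>k. rk e (u k)) = (\<Sum>b\<in>B. l b powr (p/2)) powr (1/p)"
proof -
  obtain B l where eb: "eigenbasis n I u B l"
    using exists_eigenbasis[of I u n] assms(3) by blast
  have "fin_col_norm p I (\<lambda>k. rk e (u k)) = (\<Sum>b\<in>B. l b powr (p/2)) powr (1/p)"
  proof (rule fin_col_norm_eq_of_diag_op)
    show "(\<Sum>k\<in>I. op_abs (rk e (u k)) o\<^sub>L op_abs (rk e (u k))) = diag_op B l"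
      using sum_rk_eq_diag_op[OF eb assms(3)] assms(1) by (simp add: op_abs_rk_sq)
    show "orthonormal B" using eb by (simp add: eigenbasis_def)
    show "0 \<le> l b" if "b \<in> B" for b
      using eigenbasis_eigenvalue[OF eb that] by (simp add: sum_nonneg)
  qed fact
  with eb show ?thesis by (rule that)
qed

section \<open>Column norms compared with the trace when R is at most C\<close>

context
  fixes e :: ell2 and p C :: real and n :: nat and u :: "nat \<Rightarrow> ell2"
  assumes e: "norm e = 1" and p: "p > 0" and C: "C > 0"
    and u: "\<And>k. u k \<in> real_span n"
    and bound: "\<And>m x. x \<in> real_span n \<Longrightarrow> (\<Sum>k<m. (inner (u k) x)\<^sup>2) \<le> C * (norm x)\<^sup>2"
begin

lemma eigenvalue_bounds:
  assumes "eigenbasis n I u B l" "finite I" "b \<in> B"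
  shows "0 \<le> l b" "l b \<le> C"
proof -
  have lb: "l b = (\<Sum>k\<in>I. (inner (u k) b)\<^sup>2)" using assms by (intro eigenbasis_eigenvalue)
  then show "0 \<le> l b" by (simp add: sum_nonneg)
  obtain m where "I \<subseteq> {..<m}" using assms(2) finite_nat_iff_bounded by blast
  then have "l b \<le> (\<Sum>k<m. (inner (u k) b)\<^sup>2)"
    unfolding lb by (intro sum_mono2) auto
  also have "\<dots> \<le> C * (norm b)\<^sup>2"
    using assms by (intro bound) (auto simp: eigenbasis_def)
  finally show "l b \<le> C"
    using assms orthonormal_norm[of B b] by (simp add: eigenbasis_def)
qed

text \<open>For an eigenvalue in [0, C], split off one factor of its power p/2; the remaining
  exponent p/2 - 1 is nonnegative, so C bounds that part. What is left sums to the trace.\<close>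

lemma fin_col_norm_le:
  assumes "p \<ge> 2" "finite I"
  shows "fin_col_norm p I (\<lambda>k. rk e (u k)) \<le> (C powr (p/2 - 1) * (\<Sum>k\<in>I. (norm (u k))\<^sup>2)) powr (1/p)"
proof -
  obtain B l where eb: "eigenbasis n I u B l"
    "fin_col_norm p I (\<lambda>k. rk e (u k)) = (\<Sum>b\<in>B. l b powr (p/2)) powr (1/p)"
    using fin_col_norm_rk_fixed_left[of e p I u n] e p u by blast
  have "l b powr (p/2) \<le> C powr (p/2 - 1) * l b" if "b \<in> B" for b
  proof -
    have "l b powr (p/2) = l b powr (p/2 - 1) * l b"
      using eigenvalue_bounds[OF eb(1) assms(2) that] by (simp add: powr_diff)
    also have "\<dots> \<le> C powr (p/2 - 1) * l b"
      using eigenvalue_bounds[OF eb(1) assms(2) that] assms(1) C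
      by (intro mult_right_mono powr_mono2) auto
    finally show ?thesis .
  qed
  then have "(\<Sum>b\<in>B. l b powr (p/2)) \<le> C powr (p/2 - 1) * sum l B"
    by (simp add: sum_distrib_left sum_mono)
  also have "sum l B = (\<Sum>k\<in>I. (norm (u k))\<^sup>2)" using sum_eigenvalues[OF eb(1)] u by simp
  finally show ?thesis unfolding eb(2) using p by (intro powr_mono2 sum_nonneg) auto
qed

lemma fin_col_norm_ge:
  assumes "p \<le> 2" "finite I"
  shows "(C powr (p/2 - 1) * (\<Sum>k\<in>I. (norm (u k))\<^sup>2)) powr (1/p) \<le> fin_col_norm p I (\<lambda>k. rk e (u k))"
proof -
  obtain B l where eb: "eigenbasis n I u B l"
    "fin_col_norm p I (\<lambda>k. rk e (u k)) = (\<Sum>b\<in>B. l b powr (p/2)) powr (1/p)"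
    using fin_col_norm_rk_fixed_left[of e p I u n] e p u by blast
  have "C powr (p/2 - 1) * l b \<le> l b powr (p/2)" if "b \<in> B" for b
  \<comment> \<open>The exponent p/2 - 1 is now at most 0, and monotonicity is reversed only on
    positive bases, hence the separate treatment of the eigenvalue 0.\<close>
  proof (cases "l b = 0")
    case False
    then have "l b > 0" using eigenvalue_bounds[OF eb(1) assms(2) that] by simp
    then have "C powr (p/2 - 1) * l b \<le> l b powr (p/2 - 1) * l b"
      using eigenvalue_bounds[OF eb(1) assms(2) that] assms(1) C
      by (intro mult_right_mono powr_mono2') auto
    also have "\<dots> = l b powr (p/2)" using \<open>l b > 0\<close> by (simp add: powr_diff)
    finally show ?thesis .
  qed simp
  then have "C powr (p/2 - 1) * sum l B \<le> (\<Sum>b\<in>B. l b powr (p/2))"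
    by (simp add: sum_distrib_left sum_mono)
  moreover have "sum l B = (\<Sum>k\<in>I. (norm (u k))\<^sup>2)" using sum_eigenvalues[OF eb(1)] u by simp
  ultimately show ?thesis unfolding eb(2) using p
    by (intro powr_mono2 mult_nonneg_nonneg sum_nonneg) auto
qed

lemma fin_col_norm_mono:
  assumes "I \<subseteq> J" "finite J"
  shows "fin_col_norm p I (\<lambda>k. rk e (u k)) \<le> fin_col_norm p J (\<lambda>k. rk e (u k))"
proof -
  obtain B l where eb: "eigenbasis n I u B l"
    "fin_col_norm p I (\<lambda>k. rk e (u k)) = (\<Sum>b\<in>B. l b powr (p/2)) powr (1/p)"
    using fin_col_norm_rk_fixed_left[of e p I u n] e p u by blast
  obtain B' l' where eb': "eigenbasis n J u B' l'"
    "fin_col_norm p J (\<lambda>k. rk e (u k)) = (\<Sum>b\<in>B'. l' b powr (p/2)) powr (1/p)"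
    using fin_col_norm_rk_fixed_left[of e p J u n] e p u by blast
  show ?thesis unfolding eb(2) eb'(2) using p
    by (intro powr_mono2 sum_powr_eigenvalues_mono[OF eb(1) eb'(1)] sum_nonneg assms) auto
qed

text \<open>A crude bound by the number of eigenvalues. It grows with \<open>n\<close> but is
  uniform in \<open>I\<close>, which suffices for the convergence of the partial norms.\<close>

lemma fin_col_norm_bounded:
  assumes "finite I"
  shows "fin_col_norm p I (\<lambda>k. rk e (u k)) \<le> (real n * C powr (p/2)) powr (1/p)"
proof -
  obtain B l where eb: "eigenbasis n I u B l"
    "fin_col_norm p I (\<lambda>k. rk e (u k)) = (\<Sum>b\<in>B. l b powr (p/2)) powr (1/p)"
    using fin_col_norm_rk_fixed_left[of e p I u n] e p u by blast
  have "(\<Sum>b\<in>B. l b powr (p/2)) \<le> (\<Sum>b\<in>B. C powr (p/2))"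
    using p eigenvalue_bounds[OF eb(1) assms] by (intro sum_mono powr_mono2) auto
  also have "\<dots> \<le> real n * C powr (p/2)"
    using card_eigenbasis[OF eb(1)] by (simp add: mult_right_mono)
  finally show ?thesis unfolding eb(2) using p by (intro powr_mono2 sum_nonneg) auto
qed

text \<open>Needed because \<open>lim\<close> in \<open>seq_norm\<close> is unspecified for divergent sequences.\<close>

lemma convergent_fin_col_norm: "convergent (\<lambda>m. fin_col_norm p {..<m} (\<lambda>k. rk e (u k)))"
proof (rule Bseq_mono_convergent)
  have "0 \<le> fin_col_norm p I (\<lambda>k. rk e (u k))" for I
    by (simp add: fin_col_norm_def schatten_norm_def)
  then show "Bseq (\<lambda>m. fin_col_norm p {..<m} (\<lambda>k. rk e (u k)))"
    by (intro BseqI'[where K = "(real n * C powr (p/2)) powr (1/p)"]) (simp add: fin_col_norm_bounded)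
qed (auto intro!: fin_col_norm_mono)

lemma col_norm_le:
  assumes "p \<ge> 2" "summable (\<lambda>k. (norm (u k))\<^sup>2)"
  shows "col_norm p (\<lambda>k. rk e (u k)) \<le> ennreal ((C powr (p/2 - 1) * (\<Sum>k. (norm (u k))\<^sup>2)) powr (1/p))"
proof -
  let ?h = "\<lambda>I. fin_col_norm p I (\<lambda>k. rk e (u k))"
  let ?D = "C powr (p/2 - 1)"
  have D: "?D > 0" using C by simp
  \<comment> \<open>Excludes the infinite branch of \<open>seq_norm\<close>.\<close>
  have "\<exists>M. \<forall>m\<ge>M. \<forall>n\<ge>m. ?h {m..<n} < r" if "r > 0" for r
  proof -
    \<comment> \<open>Tails below this threshold turn the bound of \<open>fin_col_norm_le\<close>
      into a number below \<open>r\<close>.\<close>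
    have "r powr p / ?D > 0" using that D by simp
    then obtain M where M: "\<forall>m\<ge>M. \<forall>n. norm (\<Sum>k=m..<n. (norm (u k))\<^sup>2) < r powr p / ?D"
      using assms(2) unfolding summable_Cauchy by blast
    have "?h {m..<n} < r" if "m \<ge> M" for m n
    proof -
      have "?h {m..<n} \<le> (?D * (\<Sum>k=m..<n. (norm (u k))\<^sup>2)) powr (1/p)"
        using assms by (intro fin_col_norm_le) auto
      also have "\<dots> < (r powr p) powr (1/p)"
        using M that D p
        by (intro powr_less_mono2 mult_nonneg_nonneg sum_nonneg)
           (auto simp: pos_less_divide_eq mult.commute sum_nonneg)
      finally show ?thesis using \<open>r > 0\<close> p by (simp add: powr_powr)
    qed
    then show ?thesis by blast
  qed
  moreover have "lim (\<lambda>m. ?h {..<m}) \<le> (?D * (\<Sum>k. (norm (u k))\<^sup>2)) powr (1/p)"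
  proof (rule LIMSEQ_le_const2)
    show "(\<lambda>m. ?h {..<m}) \<longlonglongrightarrow> lim (\<lambda>m. ?h {..<m})"
      using convergent_fin_col_norm by (simp add: convergent_LIMSEQ_iff)
    have "?h {..<m} \<le> (?D * (\<Sum>k. (norm (u k))\<^sup>2)) powr (1/p)" for m
    proof -
      have "?h {..<m} \<le> (?D * (\<Sum>k<m. (norm (u k))\<^sup>2)) powr (1/p)"
        using assms by (intro fin_col_norm_le) auto
      also have "\<dots> \<le> (?D * (\<Sum>k. (norm (u k))\<^sup>2)) powr (1/p)"
        using D p assms(2)
        by (intro powr_mono2 mult_left_mono sum_le_suminf mult_nonneg_nonneg sum_nonneg) auto
      finally show ?thesis .
    qed
    then show "\<exists>N. \<forall>m\<ge>N. ?h {..<m} \<le> (?D * (\<Sum>k. (norm (u k))\<^sup>2)) powr (1/p)" by blast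
  qed
  ultimately show ?thesis
    unfolding col_norm_def
    by (subst seq_norm_cong[OF rk_in_schatten[OF p] refl]) (auto intro: ennreal_leI)
qed

text \<open>Outside the completion the right side is infinite and the bound trivial, so only the
  limits are compared.\<close>

lemma col_norm_ge:
  assumes "p \<le> 2" "summable (\<lambda>k. (norm (u k))\<^sup>2)"
  shows "ennreal ((C powr (p/2 - 1) * (\<Sum>k. (norm (u k))\<^sup>2)) powr (1/p)) \<le> col_norm p (\<lambda>k. rk e (u k))"
proof -
  let ?h = "\<lambda>I. fin_col_norm p I (\<lambda>k. rk e (u k))"
  let ?D = "C powr (p/2 - 1)"
  have "(?D * (\<Sum>k. (norm (u k))\<^sup>2)) powr (1/p) \<le> lim (\<lambda>m. ?h {..<m})"
  proof (rule LIMSEQ_le)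
    show "(\<lambda>m. ?h {..<m}) \<longlonglongrightarrow> lim (\<lambda>m. ?h {..<m})"
      using convergent_fin_col_norm by (simp add: convergent_LIMSEQ_iff)
    show "(\<lambda>m. (?D * (\<Sum>k<m. (norm (u k))\<^sup>2)) powr (1/p)) \<longlonglongrightarrow> (?D * (\<Sum>k. (norm (u k))\<^sup>2)) powr (1/p)"
      using p by (intro tendsto_powr' tendsto_mult tendsto_const summable_LIMSEQ assms(2))
        (auto intro!: always_eventually mult_nonneg_nonneg sum_nonneg)
    show "\<exists>N. \<forall>m\<ge>N. (?D * (\<Sum>k<m. (norm (u k))\<^sup>2)) powr (1/p) \<le> ?h {..<m}"
      using assms by (auto intro!: fin_col_norm_ge)
  qed
  then show ?thesis
    unfolding col_norm_def
    by (subst seq_norm_cong[OF rk_in_schatten[OF p] refl]) (auto intro: ennreal_leI)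
qed

end

section \<open>Fractional powers of diagonal multipliers\<close>

text \<open>Domination by t^(\<alpha> - 1) near 0, where \<alpha> > 0 is used, and by t^(\<alpha> -
  1 - n) near infinity, where \<alpha> < n is used.\<close>

lemma balakrishnan_kernel_integrable:
  fixes \<alpha> :: real
  assumes "0 < \<alpha>" "\<alpha> < real n"
  shows "(\<lambda>t. t powr (\<alpha> - 1) * (1 / (t + 1)) ^ n) absolutely_integrable_on {0<..}"
    and "0 < integral {0<..} (\<lambda>t. t powr (\<alpha> - 1) * (1 / (t + 1)) ^ n)"
proof -
  let ?f = "\<lambda>t::real. t powr (\<alpha> - 1) * (1 / (t + 1)) ^ n"
  have cont: "continuous_on {0<..} ?f" by (intro continuous_intros) auto
  have "?f integrable_on {0<..1}"
  proof (rule measurable_bounded_by_integrable_imp_integrable_real)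
    show "?f \<in> borel_measurable (lebesgue_on {0<..1})"
      by (intro continuous_imp_measurable_on_sets_lebesgue continuous_on_subset[OF cont]) auto
    show "(\<lambda>t. t powr (\<alpha> - 1)) integrable_on {0<..1}"
      using integrable_on_powr_from_0'[of "\<alpha> - 1" 1] assms by simp
    show "\<bar>?f t\<bar> \<le> t powr (\<alpha> - 1)" if "t \<in> {0<..1}" for t
    proof -
      have "(1 / (t + 1)) ^ n \<le> 1" using that by (intro power_le_one) auto
      then show ?thesis using that by (simp add: abs_mult mult_left_le del: power_divide)
    qed
  qed auto
  moreover have "?f integrable_on {1..}"
  proof (rule measurable_bounded_by_integrable_imp_integrable_real)
    show "?f \<in> borel_measurable (lebesgue_on {1..})"
      by (intro continuous_imp_measurable_on_sets_lebesgue continuous_on_subset[OF cont]) auto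
    show "(\<lambda>t. t powr (\<alpha> - 1 - real n)) integrable_on {1..}"
      using has_integral_powr_to_inf[of "\<alpha> - 1 - real n" 1] assms by (auto simp: integrable_on_def)
    show "\<bar>?f t\<bar> \<le> t powr (\<alpha> - 1 - real n)" if "t \<in> {1..}" for t
    proof -
      have "(1 / (t + 1)) ^ n \<le> (1 / t) ^ n" using that by (intro power_mono divide_left_mono) auto
      then have "?f t \<le> t powr (\<alpha> - 1) * (1 / t) ^ n" by (intro mult_left_mono) auto
      also have "\<dots> = t powr (\<alpha> - 1 - real n)"
        using that by (simp add: powr_diff powr_realpow power_divide)
      finally show ?thesis using that by simp
    qed
  qed auto
  ultimately have int: "?f integrable_on {0<..}"
    by (rule integrable_Un') (auto intro: negligible_subset[of "{1}"])
  then show "?f absolutely_integrable_on {0<..}"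
    by (rule nonnegative_absolutely_integrable_1) auto
  have cont': "continuous_on {1..2} ?f" by (rule continuous_on_subset[OF cont]) auto
  have "0 < integral {1..2} ?f"
    using integral_less_real[of 1 2 "\<lambda>_. 0" ?f] cont' by simp
  also have "\<dots> \<le> integral {0<..} ?f"
    by (rule integral_subset_le[OF _ integrable_continuous_interval[OF cont'] int]) auto
  finally show "0 < integral {0<..} ?f" .
qed

text \<open>The substitution t = b s pulls out the factor b^\<alpha>: Balakrishnan's formula for a
  positive number.\<close>

lemma balakrishnan_scalar:
  fixes \<alpha> b :: real
  assumes "0 < \<alpha>" "\<alpha> < real n" "0 < b"
  shows "((\<lambda>t. t powr (\<alpha> - 1) * (b / (t + b)) ^ n) has_integral
    integral {0<..} (\<lambda>t. t powr (\<alpha> - 1) * (1 / (t + 1)) ^ n) * b powr \<alpha>) {0<..}"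
proof -
  let ?f = "\<lambda>t::real. t powr (\<alpha> - 1) * (1 / (t + 1)) ^ n"
  let ?g = "\<lambda>t. t powr (\<alpha> - 1) * (b / (t + b)) ^ n"
  have img: "(\<lambda>t. b * t) ` {0<..} = {0<..}"
  proof (intro equalityI subsetI)
    fix t :: real assume "t \<in> {0<..}"
    then have "t = b * (t / b)" "t / b \<in> {0<..}" using assms by auto
    then show "t \<in> (\<lambda>t. b * t) ` {0<..}" by blast
  qed (use assms in auto)
  have eq: "\<bar>b\<bar> * ?g (b * s) = b powr \<alpha> * ?f s" if "s \<in> {0<..}" for s
  proof -
    have "b * s + b = b * (s + 1)" by (simp add: algebra_simps)
    then have "b / (b * s + b) = 1 / (s + 1)" using assms by simp
    moreover have "b * b powr (\<alpha> - 1) = b powr \<alpha>"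
      using assms by (simp add: powr_diff)
    ultimately show ?thesis using assms that by (simp add: powr_mult) 
  qed
  have "(\<lambda>s. \<bar>b\<bar> * ?g (b * s)) absolutely_integrable_on {0<..}
    \<longleftrightarrow> (\<lambda>s. b powr \<alpha> * ?f s) absolutely_integrable_on {0<..}"
    by (intro set_integrable_cong eq refl)
  moreover have "(\<lambda>s. b powr \<alpha> * ?f s) absolutely_integrable_on {0<..}"
    using balakrishnan_kernel_integrable(1)[OF assms(1,2)] by (rule set_integrable_mult_right)
  moreover have "integral {0<..} (\<lambda>s. \<bar>b\<bar> * ?g (b * s)) = integral {0<..} (\<lambda>s. b powr \<alpha> * ?f s)"
    by (intro Henstock_Kurzweil_Integration.integral_cong eq)
  then have "integral {0<..} (\<lambda>s. \<bar>b\<bar> * ?g (b * s)) = integral {0<..} ?f * b powr \<alpha>"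
    by (simp add: mult.commute)
  ultimately have "?g absolutely_integrable_on (\<lambda>t. b * t) ` {0<..}
      \<and> integral ((\<lambda>t. b * t) ` {0<..}) ?g = integral {0<..} ?f * b powr \<alpha>"
    using assms
    by (subst has_absolute_integral_change_of_variables_1'[where g' = "\<lambda>_. b", symmetric])
       (auto intro!: derivative_eq_intros inj_onI)
  then show ?thesis
    unfolding img has_integral_iff using set_lebesgue_integral_eq_integral(1) by blast
qed

text \<open>The factor relating \<open>frac_power\<close> on an eigenvector of eigenvalue b to
  b^\<alpha>. By the Beta integral it equals 1; it is carried along as a positive constant.\<close>

definition frac_const :: "real \<Rightarrow> real"
  where "frac_const \<alpha> = (let n = nat \<lfloor>\<alpha>\<rfloor> + 1 in Gamma (real n) / (Gamma \<alpha> * Gamma (real n - \<alpha>)) *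
    integral {0<..} (\<lambda>t. t powr (\<alpha> - 1) * (1 / (t + 1)) ^ n))"

lemma less_nat_floor_add_1: "0 < \<alpha> \<Longrightarrow> \<alpha> < real (nat \<lfloor>\<alpha>\<rfloor> + 1)" for \<alpha> :: real
  by linarith

lemma frac_const_pos:
  assumes "0 < \<alpha>"
  shows "0 < frac_const \<alpha>"
proof -
  have "0 < Gamma (real (nat \<lfloor>\<alpha>\<rfloor> + 1))" "0 < Gamma \<alpha>" "0 < Gamma (real (nat \<lfloor>\<alpha>\<rfloor> + 1) - \<alpha>)"
    using assms less_nat_floor_add_1[OF assms] by (auto intro!: Gamma_real_pos)
  then show ?thesis
    unfolding frac_const_def Let_def
    using balakrishnan_kernel_integrable(2)[OF assms less_nat_floor_add_1[OF assms]]
    by (intro mult_pos_pos divide_pos_pos)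
qed

section \<open>Fractional powers on the span of finitely many eigenvectors\<close>

context
  fixes p :: real and T :: "op \<Rightarrow> op" and Y :: "nat \<Rightarrow> op" and b :: "nat \<Rightarrow> real" and N :: nat
  assumes T: "linear T" and TY: "\<And>j. T (Y j) = (1 - b j) *\<^sub>R Y j" and b: "\<And>j. 0 < b j"
    and mem: "\<And>w. (\<Sum>j<N. w j *\<^sub>R Y j) \<in> schatten p"
    and inj: "\<And>t. 0 < t \<Longrightarrow> inj_on (\<lambda>z. t *\<^sub>R z + (z - T z)) (schatten p)"
begin

lemma T_diagonal: "T (\<Sum>j<N. w j *\<^sub>R Y j) = (\<Sum>j<N. ((1 - b j) * w j) *\<^sub>R Y j)"
  using T by (simp add: linear_sum linear_scale TY mult.commute)

lemma resolvent_diagonal: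
  assumes "0 < t"
  shows "resolvent p (\<lambda>z. z - T z) t ((\<lambda>z. z - T z) (\<Sum>j<N. w j *\<^sub>R Y j)) =
    (\<Sum>j<N. (b j / (t + b j) * w j) *\<^sub>R Y j)"
  unfolding resolvent_def
\<comment> \<open>\<open>resolvent\<close> chooses a preimage in the Schatten class; injectivity
  there forces the choice to be the explicit combination.\<close>
proof (rule inv_into_f_eq[OF inj[OF assms] mem])
  let ?c = "\<lambda>j. b j / (t + b j) * w j"
  have "t *\<^sub>R (\<Sum>j<N. ?c j *\<^sub>R Y j) + ((\<Sum>j<N. ?c j *\<^sub>R Y j) - T (\<Sum>j<N. ?c j *\<^sub>R Y j)) =
    (\<Sum>j<N. (t * ?c j + (?c j - (1 - b j) * ?c j)) *\<^sub>R Y j)"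
    unfolding T_diagonal
    by (simp only: scaleR_add_left scaleR_diff_left sum.distrib sum_subtractf scaleR_sum_right scaleR_scaleR)
  also have "\<dots> = (\<Sum>j<N. (w j - (1 - b j) * w j) *\<^sub>R Y j)"
  proof (intro sum.cong refl arg_cong2[where f = scaleR])
    fix j
    have "t + b j \<noteq> 0" using b[of j] assms by simp
    have "t * c + (c - (1 - b j) * c) = (t + b j) * c" for c by (simp add: algebra_simps)
    then have "t * ?c j + (?c j - (1 - b j) * ?c j) = (t + b j) * ?c j" .
    also have "\<dots> = b j * w j" using \<open>t + b j \<noteq> 0\<close> by simp
    finally show "t * ?c j + (?c j - (1 - b j) * ?c j) = w j - (1 - b j) * w j"
      by (simp add: algebra_simps)
  qed
  also have "\<dots> = (\<Sum>j<N. w j *\<^sub>R Y j) - T (\<Sum>j<N. w j *\<^sub>R Y j)"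
    unfolding T_diagonal by (simp only: scaleR_diff_left sum_subtractf)
  finally show "t *\<^sub>R (\<Sum>j<N. ?c j *\<^sub>R Y j) + ((\<Sum>j<N. ?c j *\<^sub>R Y j) - T (\<Sum>j<N. ?c j *\<^sub>R Y j)) =
    (\<Sum>j<N. w j *\<^sub>R Y j) - T (\<Sum>j<N. w j *\<^sub>R Y j)" .
qed

lemma resolvent_power_diagonal:
  assumes "0 < t"
  shows "((\<lambda>z. resolvent p (\<lambda>z. z - T z) t ((\<lambda>z. z - T z) z)) ^^ n) (\<Sum>j<N. w j *\<^sub>R Y j) =
    (\<Sum>j<N. ((b j / (t + b j)) ^ n * w j) *\<^sub>R Y j)"
proof (induction n)
  case (Suc n)
  then show ?case
    using resolvent_diagonal[OF assms, of "\<lambda>j. (b j / (t + b j)) ^ n * w j"] by (simp add: mult.assoc)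
qed simp

text \<open>On the span of the \<open>Y j\<close> the integrand has scalar coefficients in fixed
  operators, so the operator-valued integral is a finite sum of scalar ones.\<close>

lemma frac_power_diagonal:
  assumes "0 < \<alpha>"
  shows "frac_power p (\<lambda>z. z - T z) \<alpha> (\<Sum>j<N. w j *\<^sub>R Y j) =
    (\<Sum>j<N. (frac_const \<alpha> * b j powr \<alpha> * w j) *\<^sub>R Y j)"
proof -
  define n where "n = nat \<lfloor>\<alpha>\<rfloor> + 1"
  define c where "c = integral {0<..} (\<lambda>t. t powr (\<alpha> - 1) * (1 / (t + 1)) ^ n)"
  let ?F = "\<lambda>t. t powr (\<alpha> - 1) *\<^sub>R
    ((\<lambda>z. resolvent p (\<lambda>z. z - T z) t ((\<lambda>z. z - T z) z)) ^^ n) (\<Sum>j<N. w j *\<^sub>R Y j)"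
  have "((\<lambda>t. \<Sum>j<N. (t powr (\<alpha> - 1) * (b j / (t + b j)) ^ n) *\<^sub>R (w j *\<^sub>R Y j)) has_integral
      (\<Sum>j<N. (c * b j powr \<alpha>) *\<^sub>R (w j *\<^sub>R Y j))) {0<..}"
    unfolding c_def n_def
    by (intro has_integral_sum has_integral_scaleR_left balakrishnan_scalar assms less_nat_floor_add_1 b)
      simp
  then have "(?F has_integral (\<Sum>j<N. (c * b j powr \<alpha>) *\<^sub>R (w j *\<^sub>R Y j))) {0<..}"
    by (rule has_integral_eq[rotated])
       (simp add: resolvent_power_diagonal scaleR_sum_right mult.assoc)
  then have "integral {0<..} ?F = (\<Sum>j<N. (c * b j powr \<alpha>) *\<^sub>R (w j *\<^sub>R Y j))"
    by (rule integral_unique)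
  then show ?thesis
    unfolding frac_power_def frac_const_def Let_def n_def[symmetric] c_def[symmetric]
    by (simp only: scaleR_sum_right scaleR_scaleR mult.assoc)
qed

lemma sq_seq_diagonal:
  assumes "0 < \<alpha>"
  shows "sq_seq p T \<alpha> (\<Sum>j<N. Y j) k =
    (\<Sum>j<N. (frac_const \<alpha> * real (Suc k) powr (\<alpha> - 1/2) * (1 - b j) ^ k * b j powr \<alpha>) *\<^sub>R Y j)"
proof -
  have pow: "(T ^^ k) (\<Sum>j<N. w j *\<^sub>R Y j) = (\<Sum>j<N. ((1 - b j) ^ k * w j) *\<^sub>R Y j)" for w
    by (induction k) (simp_all add: T_diagonal mult.assoc)
  have "sq_seq p T \<alpha> (\<Sum>j<N. 1 *\<^sub>R Y j) k =
    (\<Sum>j<N. (real (Suc k) powr (\<alpha> - 1/2) * ((1 - b j) ^ k * (frac_const \<alpha> * b j powr \<alpha> * 1))) *\<^sub>R Y j)"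
    unfolding sq_seq_def frac_power_diagonal[OF assms] pow
    by (simp only: scaleR_sum_right scaleR_scaleR)
  then show ?thesis by (simp add: mult_ac)
qed

end

section \<open>Left and right multiplication by the diagonal operator\<close>

context
  fixes a :: op and b :: "nat \<Rightarrow> real" and p \<alpha> :: real
  assumes a: "complex_linear a" "\<And>k. a (ket k) = (1 - b k) *\<^sub>R ket k"
    and b: "\<And>j. 0 < b j" and p: "0 < p" and \<alpha>: "0 < \<alpha>"
begin

lemma a_coord: "coord (a v) j = of_real (1 - b j) * coord v j"
  using a by (rule diagonal_coord)

lemma sq_seq_left_mult:
  "sq_seq p (left_mult a) \<alpha> (rk (\<Sum>j<N. ket j) e) =
    (\<lambda>k. rk (\<Sum>j<N. (frac_const \<alpha> * real (Suc k) powr (\<alpha> - 1/2) * (1 - b j) ^ k * b j powr \<alpha>) *\<^sub>R ket j) e)"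
proof
  fix k
  have "sq_seq p (left_mult a) \<alpha> (\<Sum>j<N. rk (ket j) e) k =
    (\<Sum>j<N. (frac_const \<alpha> * real (Suc k) powr (\<alpha> - 1/2) * (1 - b j) ^ k * b j powr \<alpha>) *\<^sub>R rk (ket j) e)"
  proof (rule sq_seq_diagonal[OF _ _ b _ _ \<alpha>])
    show "linear (left_mult a)"
      unfolding left_mult_def
      by (intro bounded_linear.linear
          bounded_bilinear.bounded_linear_right[OF bounded_bilinear_blinfun_compose])
    show "left_mult a (rk (ket j) e) = (1 - b j) *\<^sub>R rk (ket j) e" for j
      using a by (intro blinfun_eqI)
        (simp add: left_mult_def rk.rep_eq complex_linear_def scaleC_scaleR blinfun.scaleR_left)
    show "(\<Sum>j<N. w j *\<^sub>R rk (ket j) e) \<in> schatten p" for w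
      using rk_in_schatten[OF p, of "\<Sum>j<N. w j *\<^sub>R ket j" e] by (simp add: rk_sum_left rk_scaleR_left)
    \<comment> \<open>Left multiplication acts on output coordinates: the map multiplies the
      \<open>n\<close>-th coordinate of each value by the nonzero number
      \<open>t + b n\<close>.\<close>
    show "inj_on (\<lambda>z. t *\<^sub>R z + (z - left_mult a z)) (schatten p)" if "0 < t" for t
    proof (intro inj_onI blinfun_eqI ell2_eqI)
      fix x y v n
      assume "t *\<^sub>R x + (x - left_mult a x) = t *\<^sub>R y + (y - left_mult a y)"
      then have "coord ((t *\<^sub>R x + (x - left_mult a x)) v) n = coord ((t *\<^sub>R y + (y - left_mult a y)) v) n"
        by simp
      then have "of_real (t + b n) * coord (x v) n = of_real (t + b n) * coord (y v) n"
        by (simp add: blinfun.add_left blinfun.diff_left blinfun.scaleR_left coord_simps left_mult_def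
            a_coord algebra_simps)
      moreover have "(of_real (t + b n) :: complex) \<noteq> 0"
        using that b[of n] by (simp only: of_real_eq_0_iff)
      ultimately show "coord (x v) n = coord (y v) n" by simp
    qed
  qed
  then show "sq_seq p (left_mult a) \<alpha> (rk (\<Sum>j<N. ket j) e) k =
    rk (\<Sum>j<N. (frac_const \<alpha> * real (Suc k) powr (\<alpha> - 1/2) * (1 - b j) ^ k * b j powr \<alpha>) *\<^sub>R ket j) e"
    by (simp add: rk_sum_left rk_scaleR_left)
qed

lemma sq_seq_right_mult:
  "sq_seq p (right_mult a) \<alpha> (rk e (\<Sum>j<N. ket j)) =
    (\<lambda>k. rk e (\<Sum>j<N. (frac_const \<alpha> * real (Suc k) powr (\<alpha> - 1/2) * (1 - b j) ^ k * b j powr \<alpha>) *\<^sub>R ket j))"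
proof
  fix k
  have "sq_seq p (right_mult a) \<alpha> (\<Sum>j<N. rk e (ket j)) k =
    (\<Sum>j<N. (frac_const \<alpha> * real (Suc k) powr (\<alpha> - 1/2) * (1 - b j) ^ k * b j powr \<alpha>) *\<^sub>R rk e (ket j))"
  proof (rule sq_seq_diagonal[OF _ _ b _ _ \<alpha>])
    show "linear (right_mult a)"
      unfolding right_mult_def
      by (intro bounded_linear.linear
          bounded_bilinear.bounded_linear_left[OF bounded_bilinear_blinfun_compose])
    show "right_mult a (rk e (ket j)) = (1 - b j) *\<^sub>R rk e (ket j)" for j
      by (intro blinfun_eqI)
        (simp add: right_mult_def rk.rep_eq blinfun.scaleR_left cinner_ket_left a_coord
          del: of_real_diff flip: scaleC_of_real_mult)
    show "(\<Sum>j<N. w j *\<^sub>R rk e (ket j)) \<in> schatten p" for w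
      using rk_in_schatten[OF p, of e "\<Sum>j<N. w j *\<^sub>R ket j"] by (simp add: rk_sum_right rk_scaleR_right)
    \<comment> \<open>Right multiplication acts on inputs, so the operators are compared on basis
      vectors; complex linearity comes from membership in the Schatten class.\<close>
    show "inj_on (\<lambda>z. t *\<^sub>R z + (z - right_mult a z)) (schatten p)" if "0 < t" for t
    proof (intro inj_onI complex_linear_eqI)
      fix x y j
      assume "t *\<^sub>R x + (x - right_mult a x) = t *\<^sub>R y + (y - right_mult a y)"
      then have "(t *\<^sub>R x + (x - right_mult a x)) (ket j) = (t *\<^sub>R y + (y - right_mult a y)) (ket j)"
        by simp
      then have "(t + b j) *\<^sub>R x (ket j) = (t + b j) *\<^sub>R y (ket j)"
        by (simp add: blinfun.add_left blinfun.diff_left blinfun.scaleR_left blinfun.scaleR_right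
            blinfun.diff_right right_mult_def a algebra_simps)
      moreover have "t + b j \<noteq> 0" using that b[of j] by simp
      ultimately show "x (ket j) = y (ket j)" by simp
    qed (auto simp: schatten_def)
  qed
  then show "sq_seq p (right_mult a) \<alpha> (rk e (\<Sum>j<N. ket j)) k =
    rk e (\<Sum>j<N. (frac_const \<alpha> * real (Suc k) powr (\<alpha> - 1/2) * (1 - b j) ^ k * b j powr \<alpha>) *\<^sub>R ket j)"
    by (simp add: rk_sum_right rk_scaleR_right)
qed

end

section \<open>Weighted geometric series\<close>

lemma positive_tendsto_bounded:
  fixes q :: "nat \<Rightarrow> real"
  assumes "q \<longlonglongrightarrow> L" "L > 0" "\<And>k. q k > 0"
  obtains c d where "c > 0" "d > 0" "\<And>k. c \<le> q k" "\<And>k. q k \<le> d"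
proof -
  have "Bseq q" using assms(1) by (intro convergent_imp_Bseq convergentI)
  then obtain d where d: "d > 0" "\<And>k. \<bar>q k\<bar> \<le> d" unfolding Bseq_def by auto
  have "(\<lambda>k. inverse (q k)) \<longlonglongrightarrow> inverse L" using assms by (intro tendsto_inverse) auto
  then have "Bseq (\<lambda>k. inverse (q k))" by (intro convergent_imp_Bseq convergentI)
  then obtain c where c: "c > 0" "\<And>k. \<bar>inverse (q k)\<bar> \<le> c" unfolding Bseq_def by auto
  have "inverse c \<le> q k" for k
    using c(2)[of k] c(1) assms(3)[of k] by (simp add: field_simps)
  moreover have "q k \<le> d" for k using d(2)[of k] by simp
  ultimately show ?thesis using that[of "inverse c" d] c(1) d(1) by simp
qed

text \<open>Up to sign these are the binomial coefficients of exponent -s, whose growth is governed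
  by the Gamma function.\<close>

lemma pochhammer_power_asymptotic:
  fixes s :: real
  assumes "s > 0"
  shows "(\<lambda>k. pochhammer s k / fact k / real (Suc k) powr (s - 1)) \<longlonglongrightarrow> inverse (Gamma s)"
proof -
  have "(\<lambda>k. ((- s) gchoose k) / ((-1) ^ k / exp ((1 - s) * ln (real k)))) \<longlonglongrightarrow> inverse (Gamma s)"
    using gbinomial_asymptotic[of "- s"] by simp
  moreover have "\<forall>\<^sub>F k in sequentially. ((- s) gchoose k) / ((-1) ^ k / exp ((1 - s) * ln (real k))) =
      pochhammer s k / fact k * real k powr (1 - s)"
    using eventually_gt_at_top[of "0::nat"]
  proof eventually_elim
    case (elim k)
    have "((- s) gchoose k) = (-1) ^ k * (pochhammer s k / fact k)"
      by (simp add: gbinomial_pochhammer)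
    then show ?case using elim by (simp add: powr_def)
  qed
  ultimately have lim: "(\<lambda>k. pochhammer s k / fact k * real k powr (1 - s)) \<longlonglongrightarrow> inverse (Gamma s)"
    by (rule Lim_transform_eventually)
  \<comment> \<open>Passes from powers of k to powers of \<open>Suc k\<close>, as used in the
    weights.\<close>
  have "(\<lambda>k. (real (Suc k) / real k) powr (1 - s)) \<longlonglongrightarrow> 1 powr (1 - s)"
    by (intro tendsto_powr LIMSEQ_Suc_n_over_n tendsto_const) auto
  with lim have "(\<lambda>k. pochhammer s k / fact k * real k powr (1 - s) * (real (Suc k) / real k) powr (1 - s))
      \<longlonglongrightarrow> inverse (Gamma s) * 1 powr (1 - s)"
    by (rule tendsto_mult)
  then have "(\<lambda>k. pochhammer s k / fact k * real k powr (1 - s) * (real (Suc k) / real k) powr (1 - s))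
      \<longlonglongrightarrow> inverse (Gamma s)" by simp
  moreover have "\<forall>\<^sub>F k in sequentially. pochhammer s k / fact k * real k powr (1 - s) * (real (Suc k) / real k) powr (1 - s)
     = pochhammer s k / fact k / real (Suc k) powr (s - 1)"
    using eventually_gt_at_top[of "0::nat"]
  proof eventually_elim
    case (elim k)
    have "real (Suc k) powr (1 - s) = inverse (real (Suc k) powr (s - 1))"
      by (simp add: powr_minus[symmetric] del: of_nat_Suc)
    moreover have "(real (Suc k) / real k) powr (1 - s) = real (Suc k) powr (1 - s) / real k powr (1 - s)"
      by (rule powr_divide)
    ultimately show ?case using elim by (simp add: divide_inverse)
  qed
  ultimately show ?thesis by (rule Lim_transform_eventually)
qed

text \<open>The weights are comparable with the coefficients \<open>pochhammer s k / fact k\<close>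
  of the binomial series of (1 - r)^(-s). As r is nonnegative, the comparison passes to the sums,
  with constants independent of r.\<close>

lemma weighted_geometric_bounds:
  fixes s :: real
  assumes s: "s > 0"
  obtains c d where "c > 0" "d > 0"
    "\<And>r. 0 \<le> r \<Longrightarrow> r < 1 \<Longrightarrow> summable (\<lambda>k. real (Suc k) powr (s - 1) * r ^ k)"
    "\<And>r. 0 \<le> r \<Longrightarrow> r < 1 \<Longrightarrow> c * (1 - r) powr (- s) \<le> (\<Sum>k. real (Suc k) powr (s - 1) * r ^ k)"
    "\<And>r. 0 \<le> r \<Longrightarrow> r < 1 \<Longrightarrow> (\<Sum>k. real (Suc k) powr (s - 1) * r ^ k) \<le> d * (1 - r) powr (- s)"
proof -
  define g where "g = (\<lambda>k. pochhammer s k / fact k)"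
  let ?w = "\<lambda>k. real (Suc k) powr (s - 1)"
  have g: "g k > 0" for k using s by (simp add: g_def pochhammer_pos)
  have w: "?w k > 0" for k by simp
  obtain c d where cd: "c > 0" "d > 0" "\<And>k. c \<le> g k / ?w k" "\<And>k. g k / ?w k \<le> d"
  proof (rule positive_tendsto_bounded[of "\<lambda>k. g k / ?w k"])
    show "(\<lambda>k. g k / ?w k) \<longlonglongrightarrow> inverse (Gamma s)"
      unfolding g_def by (rule pochhammer_power_asymptotic[OF s])
    show "inverse (Gamma s) > 0" using s by (simp add: Gamma_real_pos)
  qed (use g in auto)
  have up: "?w k \<le> inverse c * g k" and low: "inverse d * g k \<le> ?w k" for k
    using cd(3)[of k] cd(4)[of k] cd(1,2) w[of k]
    by (simp_all add: field_simps del: of_nat_Suc)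
  have series: "(\<lambda>k. g k * r ^ k) sums (1 - r) powr (- s)" if "0 \<le> r" "r < 1" for r
  proof -
    have "((- s) gchoose k) * (- r) ^ k = g k * r ^ k" for k
      unfolding gbinomial_pochhammer power_minus[of r] by (simp add: g_def)
    then show ?thesis using gen_binomial_real[of "- r" "- s"] that by simp
  qed
  show ?thesis
  proof (rule that[of "inverse d" "inverse c"])
    fix r :: real assume r: "0 \<le> r" "r < 1"
    have sg: "summable (\<lambda>k. g k * r ^ k)" and eg: "(\<Sum>k. g k * r ^ k) = (1 - r) powr (- s)"
      using series[OF r] by (auto simp: sums_iff)
    have upr: "?w k * r ^ k \<le> inverse c * (g k * r ^ k)" for k
      using mult_right_mono[OF up[of k], of "r ^ k"] r by (simp add: mult.assoc)
    have lowr: "inverse d * (g k * r ^ k) \<le> ?w k * r ^ k" for k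
      using mult_right_mono[OF low[of k], of "r ^ k"] r by (simp add: mult.assoc)
    show sw: "summable (\<lambda>k. ?w k * r ^ k)"
      by (rule summable_comparison_test'[OF summable_mult[OF sg, of "inverse c"], of 0])
         (use upr r in auto)
    show "inverse d * (1 - r) powr (- s) \<le> (\<Sum>k. ?w k * r ^ k)"
      unfolding eg[symmetric] suminf_mult[OF sg, symmetric]
      by (intro suminf_le lowr sw summable_mult sg)
    show "(\<Sum>k. ?w k * r ^ k) \<le> inverse c * (1 - r) powr (- s)"
      unfolding eg[symmetric] suminf_mult[OF sg, symmetric]
      by (intro suminf_le upr sw summable_mult sg)
  qed (use cd in auto)
qed

section \<open>Row sums of geometrically decaying matrices and the Schur test\<close>

lemma sum_geometric_inj_le:
  fixes r :: real
  assumes "0 \<le> r" "r < 1" "finite A" "inj_on f A"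
  shows "(\<Sum>j\<in>A. r ^ f j) \<le> 1 / (1 - r)"
proof -
  have "(\<Sum>j\<in>A. r ^ f j) = (\<Sum>k\<in>f ` A. r ^ k)" using assms by (simp add: sum.reindex)
  also have "\<dots> \<le> (\<Sum>k. r ^ k)" using assms by (intro sum_le_suminf summable_geometric) auto
  finally show ?thesis using assms by (simp add: suminf_geometric)
qed

text \<open>With truncated subtraction, \<open>(i - j) + (j - i)\<close> is the distance of \<open>i\<close> and \<open>j\<close>.\<close>

lemma sum_geometric_dist_le:
  fixes r :: real
  assumes "0 \<le> r" "r < 1"
  shows "(\<Sum>j<n. r ^ ((i - j) + (j - i))) \<le> 2 / (1 - r)"
proof -
  \<comment> \<open>The two ranges share j = i, which is harmless for an upper bound.\<close>
  have "(\<Sum>j<n. r ^ ((i - j) + (j - i))) \<le>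
      (\<Sum>j<n. (if j \<le> i then r ^ (i - j) else 0) + (if i \<le> j then r ^ (j - i) else 0))"
    using assms by (intro sum_mono) auto
  also have "\<dots> = (\<Sum>j\<in>{j. j < n \<and> j \<le> i}. r ^ (i - j)) + (\<Sum>j\<in>{j. j < n \<and> i \<le> j}. r ^ (j - i))"
    by (simp add: sum.distrib sum.inter_filter[symmetric] flip: lessThan_iff)
  also have "\<dots> \<le> 1 / (1 - r) + 1 / (1 - r)"
    using assms by (intro add_mono sum_geometric_inj_le) (auto intro!: inj_onI)
  finally show ?thesis by simp
qed

text \<open>Bound x_i x_j by the mean of the squares; by symmetry both halves are the same sum,
  controlled by the row sums.\<close>

lemma schur_test_symmetric:
  fixes M :: "nat \<Rightarrow> nat \<Rightarrow> real"
  assumes M: "\<And>i j. i < n \<Longrightarrow> j < n \<Longrightarrow> 0 \<le> M i j" "\<And>i j. M i j = M j i"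
    and row: "\<And>i. i < n \<Longrightarrow> (\<Sum>j<n. M i j) \<le> D"
  shows "(\<Sum>i<n. \<Sum>j<n. x i * x j * M i j) \<le> D * (\<Sum>i<n. (x i)\<^sup>2)"
proof -
  have "x i * x j * M i j \<le> ((x i)\<^sup>2 * M i j + (x j)\<^sup>2 * M i j) / 2" if "i < n" "j < n" for i j
  proof -
    have "x i * x j \<le> ((x i)\<^sup>2 + (x j)\<^sup>2) / 2"
      using sum_squares_bound[of "x i" "x j"] by simp
    from mult_right_mono[OF this M(1)[OF that]] show ?thesis by (simp add: algebra_simps)
  qed
  then have "(\<Sum>i<n. \<Sum>j<n. x i * x j * M i j) \<le> (\<Sum>i<n. \<Sum>j<n. ((x i)\<^sup>2 * M i j + (x j)\<^sup>2 * M i j) / 2)"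
    by (intro sum_mono) auto
  also have "\<dots> = ((\<Sum>i<n. \<Sum>j<n. (x i)\<^sup>2 * M i j) + (\<Sum>i<n. \<Sum>j<n. (x j)\<^sup>2 * M i j)) / 2"
    by (simp add: sum.distrib add_divide_distrib sum_divide_distrib)
  also have "(\<Sum>i<n. \<Sum>j<n. (x j)\<^sup>2 * M i j) = (\<Sum>i<n. \<Sum>j<n. (x i)\<^sup>2 * M i j)"
    by (subst sum.swap) (simp add: M(2))
  also have "((\<Sum>i<n. \<Sum>j<n. (x i)\<^sup>2 * M i j) + (\<Sum>i<n. \<Sum>j<n. (x i)\<^sup>2 * M i j)) / 2 = (\<Sum>i<n. \<Sum>j<n. (x i)\<^sup>2 * M i j)" by simp
  also have "(\<Sum>i<n. \<Sum>j<n. (x i)\<^sup>2 * M i j) = (\<Sum>i<n. (x i)\<^sup>2 * (\<Sum>j<n. M i j))"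
    by (simp add: sum_distrib_left)
  also have "\<dots> \<le> (\<Sum>i<n. (x i)\<^sup>2 * D)"
    by (intro sum_mono mult_left_mono row) auto
  finally show ?thesis by (simp add: sum_distrib_left mult.commute)
qed

section \<open>The test vectors\<close>

text \<open>
  The \<open>k\<close>-th term of the square function of \<open>rk (\<Sum>j<n. ket j) e\<close> under \<open>left_mult a\<close> is
  \<open>rk (test_vec \<alpha> n k) e\<close>, and similarly for \<open>right_mult a\<close>.
\<close>

definition test_coeff :: "real \<Rightarrow> nat \<Rightarrow> nat \<Rightarrow> real"
  where "test_coeff \<alpha> k j = frac_const \<alpha> * real (Suc k) powr (\<alpha> - 1/2) *
    (1 - 1 / 2 ^ (j + 1)) ^ k * (1 / 2 ^ (j + 1)) powr \<alpha>"

definition test_vec :: "real \<Rightarrow> nat \<Rightarrow> nat \<Rightarrow> ell2"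
  where "test_vec \<alpha> n k = (\<Sum>j<n. test_coeff \<alpha> k j *\<^sub>R ket j)"

lemma test_vec_in_real_span: "test_vec \<alpha> n k \<in> real_span n"
  unfolding test_vec_def real_span_def by (intro span_sum span_scale span_base) auto

lemma inner_sum_ket: "inner (\<Sum>j<n. c j *\<^sub>R ket j) x = (\<Sum>j<n. c j * inner (ket j) x)"
  by (simp add: inner_sum_left)

lemma norm_sum_ket: "(norm (\<Sum>j<n. c j *\<^sub>R ket j))\<^sup>2 = (\<Sum>j<n. (c j)\<^sup>2)"
proof -
  have "inner (ket j) (\<Sum>i<n. c i *\<^sub>R ket i) = (if j < n then c j else 0)" for j
  proof -
    have "inner (ket j) (\<Sum>i<n. c i *\<^sub>R ket i) = (\<Sum>i<n. if i = j then c j else 0)"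
      unfolding inner_sum_right by (intro sum.cong) (auto simp: inner_ket)
    then show ?thesis by simp
  qed
  then show ?thesis
    by (simp add: power2_norm_eq_inner inner_sum_ket power2_eq_square[of "c _"])
qed

lemma norm_real_span: "x \<in> real_span n \<Longrightarrow> (norm x)\<^sup>2 = (\<Sum>j<n. (inner (ket j) x)\<^sup>2)"
  using norm_sum_ket[where n = n and c = "\<lambda>j. inner (ket j) x"] real_span_expand[of x n] by simp

text \<open>Summed over \<open>k\<close>, this becomes a weighted geometric series with s =
  2\<alpha> and ratio a_i a_j.\<close>

lemma test_coeff_mult:
  "test_coeff \<alpha> k i * test_coeff \<alpha> k j = (frac_const \<alpha>)\<^sup>2 * (1 / 2 ^ (i + 1) * (1 / 2 ^ (j + 1))) powr \<alpha> *
    (real (Suc k) powr (2 * \<alpha> - 1) * ((1 - 1 / 2 ^ (i + 1)) * (1 - 1 / 2 ^ (j + 1))) ^ k)"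
proof -
  have "real (Suc k) powr (2 * \<alpha> - 1) = real (Suc k) powr (\<alpha> - 1/2) * real (Suc k) powr (\<alpha> - 1/2)"
    by (simp flip: powr_add)
  then show ?thesis
    unfolding test_coeff_def power_mult_distrib powr_mult power2_eq_square
    by (simp only: mult_ac)
qed

lemma test_coeff_pos: "0 < \<alpha> \<Longrightarrow> 0 < test_coeff \<alpha> k j"
proof -
  assume "0 < \<alpha>"
  moreover have "(1::real) < 2 ^ (j + 1)" by (rule one_less_power) auto
  then have "0 < 1 - 1 / (2::real) ^ (j + 1)" by simp
  ultimately show ?thesis
    unfolding test_coeff_def by (intro mult_pos_pos frac_const_pos zero_less_power) auto
qed

text \<open>
  Almost orthogonality: the \<open>(i, j)\<close> entry of \<open>\<Sum>k. |u\<^sub>k\<rangle>\<langle>u\<^sub>k|\<close> is of order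
  \<open>(b\<^sub>i b\<^sub>j)\<^sup>\<alpha> (1 - a\<^sub>i a\<^sub>j)\<^bsup>-2\<alpha>\<^esup>\<close>, with \<open>b\<^sub>i = 1 - a\<^sub>i = 2\<^bsup>-(i+1)\<^esup>\<close>, where \<open>1 - a\<^sub>i a\<^sub>j \<ge> max b\<^sub>i b\<^sub>j\<close>, so it decays geometrically
  in the distance of \<open>i\<close> and \<open>j\<close>.
\<close>

lemma almost_orthogonal_factor:
  fixes \<alpha> :: real
  assumes "0 < \<alpha>"
  shows "(1 / 2 ^ (i + 1) * (1 / 2 ^ (j + 1))) powr \<alpha> *
      (1 - (1 - 1 / 2 ^ (i + 1)) * (1 - 1 / 2 ^ (j + 1))) powr (- (2 * \<alpha>))
    \<le> ((1/2) powr \<alpha>) ^ ((i - j) + (j - i))"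
proof (induction i j rule: linorder_wlog)
  case (sym i j)
  then show ?case by (simp add: mult.commute add.commute)
next
  case (le i j)
  define b c :: real where "b = 1 / 2 ^ (i + 1)" and "c = 1 / 2 ^ (j + 1)"
  have bc: "0 < b" "0 < c" "b \<le> 1"
    using one_le_power[of "2::real" "i + 1"] by (auto simp: b_def c_def)
  have c_eq: "c = b * (1/2) ^ (j - i)"
    using le by (simp add: b_def c_def power_diff power_one_over field_simps)
  \<comment> \<open>As i \<le> j, \<open>b\<close> is the larger of the two numbers; replacing the
    difference by \<open>b\<close> leaves (c/b)^\<alpha>, a power of 2^(-\<alpha>).\<close>
  have "b \<le> 1 - (1 - b) * (1 - c)"
    using bc mult_right_mono[of b 1 c] by (simp add: algebra_simps)
  then have "(1 - (1 - b) * (1 - c)) powr (- (2 * \<alpha>)) \<le> b powr (- (2 * \<alpha>))"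
    using bc assms by (intro powr_mono2') auto
  then have "(b * c) powr \<alpha> * (1 - (1 - b) * (1 - c)) powr (- (2 * \<alpha>)) \<le> (b * c) powr \<alpha> * b powr (- (2 * \<alpha>))"
    by (rule mult_left_mono) simp
  also have "\<dots> = ((1/2) ^ (j - i)) powr \<alpha>"
    unfolding c_eq using bc by (simp add: powr_mult powr_minus mult.assoc[symmetric] flip: powr_add)
  also have "\<dots> = ((1/2) powr \<alpha>) ^ (j - i)"
    by (simp add: powr_powr mult.commute flip: powr_realpow)
  finally show ?case using le by (simp add: b_def c_def)
qed

lemma eigenvalue_mult_bounds:
  "0 \<le> (1 - 1 / 2 ^ (i + 1)) * (1 - 1 / (2::real) ^ (j + 1))"
  "(1 - 1 / 2 ^ (i + 1)) * (1 - 1 / (2::real) ^ (j + 1)) < 1"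
proof -
  have b: "0 < 1 / (2::real) ^ (m + 1)" "1 / (2::real) ^ (m + 1) < 1" for m
    using one_less_power[of "2::real" "m + 1"] by auto
  show "0 \<le> (1 - 1 / 2 ^ (i + 1)) * (1 - 1 / (2::real) ^ (j + 1))"
    using b(2)[of i] b(2)[of j] by (intro mult_nonneg_nonneg) simp_all
  have "(1 - 1 / 2 ^ (i + 1)) * (1 - 1 / (2::real) ^ (j + 1)) < 1 * 1"
    using b[of i] b[of j] by (intro mult_strict_mono) simp_all
  then show "(1 - 1 / 2 ^ (i + 1)) * (1 - 1 / (2::real) ^ (j + 1)) < 1" by simp
qed

text \<open>The Schur test for the matrix of R gives the upper bound, and the diagonal entries alone
  give the growth of the trace. Both constants are fixed before \<open>n\<close>.\<close>

lemma test_vec_estimates: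
  assumes \<alpha>: "0 < \<alpha>"
  obtains C \<delta> where "0 < C" "0 < \<delta>"
    "\<And>n m x. x \<in> real_span n \<Longrightarrow> (\<Sum>k<m. (inner (test_vec \<alpha> n k) x)\<^sup>2) \<le> C * (norm x)\<^sup>2"
    "\<And>n. summable (\<lambda>k. (norm (test_vec \<alpha> n k))\<^sup>2)"
    "\<And>n. \<delta> * real n \<le> (\<Sum>k. (norm (test_vec \<alpha> n k))\<^sup>2)"
proof -
  let ?b = "\<lambda>j::nat. 1 / (2::real) ^ (j + 1)"
  let ?\<kappa> = "frac_const \<alpha>"
  let ?a = "\<lambda>i j. (1 - ?b i) * (1 - ?b j)"
  let ?S = "\<lambda>r. \<Sum>k. real (Suc k) powr (2 * \<alpha> - 1) * r ^ k"
  obtain c d where cd: "c > 0" "d > 0"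
    and sm: "\<And>r. 0 \<le> r \<Longrightarrow> r < 1 \<Longrightarrow> summable (\<lambda>k. real (Suc k) powr (2 * \<alpha> - 1) * r ^ k)"
    and low: "\<And>r. 0 \<le> r \<Longrightarrow> r < 1 \<Longrightarrow> c * (1 - r) powr (- (2 * \<alpha>)) \<le> ?S r"
    and up: "\<And>r. 0 \<le> r \<Longrightarrow> r < 1 \<Longrightarrow> ?S r \<le> d * (1 - r) powr (- (2 * \<alpha>))"
    by (rule weighted_geometric_bounds[of "2 * \<alpha>"], use \<alpha> in simp) (rule that)
  have \<kappa>: "0 < ?\<kappa>" using frac_const_pos[OF \<alpha>] .
  define \<rho> where "\<rho> = (1/2::real) powr \<alpha>"
  have \<rho>: "0 \<le> \<rho>" "\<rho> < 1"
    using \<alpha> powr_less_mono2[of \<alpha> "1/2" 1] by (simp_all add: \<rho>_def)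
  \<comment> \<open>\<open>d\<close> comes from the upper bound for the series, the last factor from
    the row sums of \<rho>^|i - j|.\<close>
  define C where "C = ?\<kappa>\<^sup>2 * d * (2 / (1 - \<rho>))"
  \<comment> \<open>\<open>c\<close> comes from the lower bound for the series, the power of 2 from
    1 - a_j^2 \<le> 2 b_j.\<close>
  define \<delta> where "\<delta> = ?\<kappa>\<^sup>2 * c * 2 powr (- (2 * \<alpha>))"
  have sums: "(\<lambda>k. test_coeff \<alpha> k i * test_coeff \<alpha> k j) sums (?\<kappa>\<^sup>2 * (?b i * ?b j) powr \<alpha> * ?S (?a i j))" for i j
    unfolding test_coeff_mult by (intro sums_mult summable_sums sm eigenvalue_mult_bounds)
  show ?thesis
  proof (rule that[of C \<delta>])
    show "0 < C" "0 < \<delta>" using \<kappa> cd \<rho> by (simp_all add: C_def \<delta>_def)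
    fix n
    have sums_norm: "(\<lambda>k. (norm (test_vec \<alpha> n k))\<^sup>2) sums (\<Sum>j<n. ?\<kappa>\<^sup>2 * (?b j * ?b j) powr \<alpha> * ?S (?a j j))"
      unfolding test_vec_def norm_sum_ket power2_eq_square[of "test_coeff _ _ _"] by (intro sums_sum sums)
    then show "summable (\<lambda>k. (norm (test_vec \<alpha> n k))\<^sup>2)" by (simp add: sums_iff)
    have "\<delta> \<le> ?\<kappa>\<^sup>2 * (?b j * ?b j) powr \<alpha> * ?S (?a j j)" for j
    proof -
      have b: "0 < ?b j" by simp
      have "c * (2 * ?b j) powr (- (2 * \<alpha>)) \<le> c * (1 - ?a j j) powr (- (2 * \<alpha>))"
        using eigenvalue_mult_bounds[of j j] \<alpha> cd b
        by (intro mult_left_mono powr_mono2') (auto simp: algebra_simps)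
      also have "\<dots> \<le> ?S (?a j j)" by (intro low eigenvalue_mult_bounds)
      finally have "?\<kappa>\<^sup>2 * (?b j * ?b j) powr \<alpha> * (c * (2 * ?b j) powr (- (2 * \<alpha>)))
          \<le> ?\<kappa>\<^sup>2 * (?b j * ?b j) powr \<alpha> * ?S (?a j j)"
        by (intro mult_left_mono) auto
      moreover have "(?b j * ?b j) powr \<alpha> * (2 * ?b j) powr (- (2 * \<alpha>)) = 2 powr (- (2 * \<alpha>))"
      proof -
        have "(r * r) powr \<alpha> * (2 * r) powr (- (2 * \<alpha>)) = 2 powr (- (2 * \<alpha>))" if "r > 0" for r :: real
          using that by (simp add: powr_mult powr_minus flip: powr_add)
        then show ?thesis using b by blast
      qed
      ultimately show ?thesis by (simp add: \<delta>_def mult.assoc mult.left_commute)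
    qed
    then have "(\<Sum>j<n. \<delta>) \<le> (\<Sum>j<n. ?\<kappa>\<^sup>2 * (?b j * ?b j) powr \<alpha> * ?S (?a j j))"
      by (intro sum_mono)
    then show "\<delta> * real n \<le> (\<Sum>k. (norm (test_vec \<alpha> n k))\<^sup>2)"
      using sums_norm by (simp add: sums_iff mult.commute)
    fix m x assume x: "x \<in> real_span n"
    let ?x = "\<lambda>j. inner (ket j) x"
    let ?M = "\<lambda>i j. ?\<kappa>\<^sup>2 * d * \<rho> ^ ((i - j) + (j - i))"
    have M: "(\<Sum>k<m. test_coeff \<alpha> k i * test_coeff \<alpha> k j) \<le> ?M i j" for i j
    proof -
      have "(\<Sum>k<m. test_coeff \<alpha> k i * test_coeff \<alpha> k j) \<le> ?\<kappa>\<^sup>2 * (?b i * ?b j) powr \<alpha> * ?S (?a i j)"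
        using sums[of i j] test_coeff_pos[OF \<alpha>] by (subst sums_unique[OF sums])
          (intro sum_le_suminf, auto simp: sums_iff intro!: mult_nonneg_nonneg less_imp_le)
      also have "\<dots> \<le> ?\<kappa>\<^sup>2 * (?b i * ?b j) powr \<alpha> * (d * (1 - ?a i j) powr (- (2 * \<alpha>)))"
        by (intro mult_left_mono up eigenvalue_mult_bounds) auto
      also have "\<dots> = ?\<kappa>\<^sup>2 * d * ((?b i * ?b j) powr \<alpha> * (1 - ?a i j) powr (- (2 * \<alpha>)))"
        by (simp only: mult_ac)
      also have "\<dots> \<le> ?M i j"
        unfolding \<rho>_def using cd by (intro mult_left_mono almost_orthogonal_factor \<alpha>) auto
      finally show ?thesis .
    qed
    have "(\<Sum>k<m. (inner (test_vec \<alpha> n k) x)\<^sup>2) =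
        (\<Sum>k<m. \<Sum>i<n. \<Sum>j<n. ?x i * ?x j * (test_coeff \<alpha> k i * test_coeff \<alpha> k j))"
      by (simp add: test_vec_def inner_sum_left power2_eq_square sum_product mult_ac)
    also have "\<dots> = (\<Sum>i<n. \<Sum>j<n. ?x i * ?x j * (\<Sum>k<m. test_coeff \<alpha> k i * test_coeff \<alpha> k j))"
      by (simp add: sum_distrib_left sum.swap[of _ _ "{..<m}"])
    \<comment> \<open>The Gram sums are nonnegative, so replacing the coordinates of
      \<open>x\<close> by their absolute values can only increase the form.\<close>
    also have "\<dots> \<le> (\<Sum>i<n. \<Sum>j<n. \<bar>?x i\<bar> * \<bar>?x j\<bar> * ?M i j)"
    proof (intro sum_mono)
      fix i j
      let ?G = "\<Sum>k<m. test_coeff \<alpha> k i * test_coeff \<alpha> k j"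
      have "0 \<le> ?G"
        using test_coeff_pos[OF \<alpha>] by (intro sum_nonneg mult_nonneg_nonneg less_imp_le)
      have "?x i * ?x j * ?G \<le> \<bar>?x i * ?x j * ?G\<bar>" by (rule abs_ge_self)
      also have "\<dots> = \<bar>?x i\<bar> * \<bar>?x j\<bar> * ?G" using \<open>0 \<le> ?G\<close> by (simp add: abs_mult)
      also have "\<dots> \<le> \<bar>?x i\<bar> * \<bar>?x j\<bar> * ?M i j" by (intro mult_left_mono M) auto
      finally show "?x i * ?x j * ?G \<le> \<bar>?x i\<bar> * \<bar>?x j\<bar> * ?M i j" .
    qed
    also have "\<dots> \<le> C * (\<Sum>i<n. \<bar>?x i\<bar>\<^sup>2)"
    proof (rule schur_test_symmetric)
      show "0 \<le> ?M i j" for i j using cd \<rho> by simp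
      show "?M i j = ?M j i" for i j by (simp add: add.commute)
      show "(\<Sum>j<n. ?M i j) \<le> C" for i
        unfolding sum_distrib_left[symmetric] C_def
        using cd \<rho> by (intro mult_left_mono sum_geometric_dist_le) auto
    qed
    also have "\<dots> = C * (norm x)\<^sup>2" by (simp add: norm_real_span[OF x])
    finally show "(\<Sum>k<m. (inner (test_vec \<alpha> n k) x)\<^sup>2) \<le> C * (norm x)\<^sup>2" .
  qed
qed

text \<open>As \<open>t\<close> is unbounded, the positive power r - s of \<open>t n\<close>
  eventually exceeds any constant.\<close>

lemma no_linear_bound:
  fixes r s \<delta> D :: real
  assumes "0 < s" "s < r" "0 < \<delta>" "0 < D" and t: "\<And>n. \<delta> * real n \<le> t n"
  obtains n where "ennreal K * ennreal (D * t n powr s) < ennreal (t n powr r)"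
proof -
  \<comment> \<open>The absolute value covers negative \<open>K\<close>, for which
    \<open>ennreal K\<close> is 0; adding 1 makes \<open>E\<close> positive.\<close>
  define E where "E = \<bar>K\<bar> * D + 1"
  obtain n where n: "(E powr (1 / (r - s)) + 1) / \<delta> < real n"
    using reals_Archimedean2 by blast
  have E: "E > 0" using assms by (simp add: E_def add_nonneg_pos)
  have "E powr (1 / (r - s)) + 1 < \<delta> * real n"
    using n \<open>0 < \<delta>\<close> by (simp add: pos_divide_less_eq mult.commute)
  then have "E powr (1 / (r - s)) + 1 < t n" using t by (rule less_le_trans)
  then have "t n > 0" and "E powr (1 / (r - s)) < t n"
    using powr_ge_zero[of E "1 / (r - s)"] by linarith+
  then have "(E powr (1 / (r - s))) powr (r - s) < t n powr (r - s)"
    using assms by (intro powr_less_mono2) auto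
  then have "E < t n powr (r - s)" using assms E by (simp add: powr_powr)
  then have "E * t n powr s < t n powr (r - s) * t n powr s"
    using \<open>t n > 0\<close> by (intro mult_strict_right_mono) auto
  then have lt: "E * t n powr s < t n powr r" by (simp flip: powr_add)
  have "ennreal K * ennreal (D * t n powr s) \<le> ennreal \<bar>K\<bar> * ennreal (D * t n powr s)"
    by (intro mult_right_mono ennreal_leI) auto
  also have "\<dots> = ennreal (\<bar>K\<bar> * (D * t n powr s))"
    using assms by (simp add: ennreal_mult)
  also have "\<dots> < ennreal (t n powr r)"
  proof (rule ennreal_lessI)
    have "\<bar>K\<bar> * (D * t n powr s) \<le> E * t n powr s"
      by (simp add: E_def algebra_simps)
    with lt show "\<bar>K\<bar> * (D * t n powr s) < t n powr r" by simp
  qed (use \<open>t n > 0\<close> in simp)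
  finally show ?thesis by (rule that)
qed

theorem theorem4p3:
  fixes \<alpha> p :: real and a :: op
  assumes "\<alpha> > 0"
    and "complex_linear a"
    and "\<forall>k. a (ket k) = (1 - 1 / 2 ^ (k + 1)) *\<^sub>R ket k"
    and "1 < p"
  shows "(2 < p \<longrightarrow>
       \<not> (\<exists>K::real. \<forall>x\<in>schatten p.
            sq_col p (left_mult a) \<alpha> x \<le> ennreal K * sq_row p (left_mult a) \<alpha> x)
     \<and> \<not> (\<exists>K::real. \<forall>x\<in>schatten p.
            sq_row p (right_mult a) \<alpha> x \<le> ennreal K * sq_col p (right_mult a) \<alpha> x))
   \<and> (p < 2 \<longrightarrow>
       \<not> (\<exists>K::real. \<forall>x\<in>schatten p.
            sq_row p (left_mult a) \<alpha> x \<le> ennreal K * sq_col p (left_mult a) \<alpha> x)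
     \<and> \<not> (\<exists>K::real. \<forall>x\<in>schatten p.
            sq_col p (right_mult a) \<alpha> x \<le> ennreal K * sq_row p (right_mult a) \<alpha> x))"
proof -
  let ?e = "ket 0"
  let ?x = "\<lambda>n. rk (\<Sum>j<n. ket j) ?e" and ?y = "\<lambda>n. rk ?e (\<Sum>j<n. ket j)"
  have p: "0 < p" using assms by simp
  obtain C \<delta> where C: "0 < C" and \<delta>: "0 < \<delta>"
    and bound: "\<And>n m x. x \<in> real_span n \<Longrightarrow> (\<Sum>k<m. (inner (test_vec \<alpha> n k) x)\<^sup>2) \<le> C * (norm x)\<^sup>2"
    and sm: "\<And>n. summable (\<lambda>k. (norm (test_vec \<alpha> n k))\<^sup>2)"
    and low: "\<And>n. \<delta> * real n \<le> (\<Sum>k. (norm (test_vec \<alpha> n k))\<^sup>2)"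
    by (rule test_vec_estimates[OF assms(1)]) (rule that)
  define t where "t = (\<lambda>n. \<Sum>k. (norm (test_vec \<alpha> n k))\<^sup>2)"
  \<comment> \<open>The common value of the two hard square functions, left row and right column;
    the other two equal the square root of \<open>t n\<close>.\<close>
  define H where "H = (\<lambda>n. col_norm p (\<lambda>k. rk ?e (test_vec \<alpha> n k)))"
  define D where "D = (C powr (p/2 - 1)) powr (1/p)"
  have t_nonneg: "0 \<le> t n" for n unfolding t_def by (intro suminf_nonneg sm) auto
  have low_t: "\<delta> * real n \<le> t n" for n using low by (simp add: t_def)
  have D: "0 < D" using C by (simp add: D_def)
  have D_t: "(C powr (p/2 - 1) * t n) powr (1/p) = D * t n powr (1/p)" for n
    by (simp add: D_def powr_mult)
  have left: "sq_seq p (left_mult a) \<alpha> (?x n) = (\<lambda>k. rk (test_vec \<alpha> n k) ?e)" for n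
    unfolding test_vec_def test_coeff_def
    by (rule sq_seq_left_mult[where b = "\<lambda>j. 1 / 2 ^ (j + 1)"]) (use assms p in auto)
  have right: "sq_seq p (right_mult a) \<alpha> (?y n) = (\<lambda>k. rk ?e (test_vec \<alpha> n k))" for n
    unfolding test_vec_def test_coeff_def
    by (rule sq_seq_right_mult[where b = "\<lambda>j. 1 / 2 ^ (j + 1)"]) (use assms p in auto)
  have easy: "sq_col p (left_mult a) \<alpha> (?x n) = ennreal (t n powr (1/2))"
    "sq_row p (right_mult a) \<alpha> (?y n) = ennreal (t n powr (1/2))" for n
    using t_nonneg[of n] p sm[of n]
    by (simp_all add: sq_col_def sq_row_def left right col_norm_rk_fixed_right row_norm_rk_fixed_left
        norm_ket powr_half_sqrt t_def)
  have hard: "sq_row p (left_mult a) \<alpha> (?x n) = H n" "sq_col p (right_mult a) \<alpha> (?y n) = H n" for n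
    using p by (simp_all add: sq_col_def sq_row_def left right row_norm_eq_col_norm_adj H_def)
  have mem: "?x n \<in> schatten p" "?y n \<in> schatten p" for n
    using p by (simp_all add: rk_in_schatten)
  have H_le: "H n \<le> ennreal (D * t n powr (1/p))" if "2 < p" for n
    using col_norm_le[OF norm_ket p C test_vec_in_real_span bound _ sm] that
    unfolding H_def D_t[symmetric] unfolding t_def by simp
  have H_ge: "ennreal (D * t n powr (1/p)) \<le> H n" if "p < 2" for n
    using col_norm_ge[OF norm_ket p C test_vec_in_real_span bound _ sm] that
    unfolding H_def D_t[symmetric] unfolding t_def by simp
  have gt2: "\<exists>n. ennreal K * H n < ennreal (t n powr (1/2))" if p2: "2 < p" for K
  proof -
    obtain n where "ennreal K * ennreal (D * t n powr (1/p)) < ennreal (t n powr (1/2))"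
      by (rule no_linear_bound[of "1/p" "1/2" \<delta> D t K]) (use p2 \<delta> D low_t in \<open>auto simp: field_simps\<close>)
    then show ?thesis using H_le[OF p2] by (meson le_less_trans mult_left_mono zero_le)
  qed
  have lt2: "\<exists>n. ennreal K * ennreal (t n powr (1/2)) < H n" if p2: "p < 2" for K
  proof -
    \<comment> \<open>For p < 2 the factor \<open>D\<close> sits on the larger side, so the growth
      lemma is used with \<open>K / D\<close> and the result multiplied by \<open>D\<close>.\<close>
    obtain n where n: "ennreal (K / D) * ennreal (1 * t n powr (1/2)) < ennreal (t n powr (1/p))"
      by (rule no_linear_bound[of "1/2" "1/p" \<delta> 1 t "K / D"]) (use p p2 \<delta> low_t in \<open>auto simp: field_simps\<close>)
    have "ennreal K * ennreal (t n powr (1/2)) = ennreal D * (ennreal (K / D) * ennreal (1 * t n powr (1/2)))"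
      using D by (cases "0 \<le> K") (simp_all add: ennreal_mult'[symmetric] ennreal_neg divide_nonpos_pos)
    also have "\<dots> < ennreal D * ennreal (t n powr (1/p))"
      using n D by (intro ennreal_mult_strict_left_mono) auto
    also have "\<dots> = ennreal (D * t n powr (1/p))" using D by (simp add: ennreal_mult)
    also have "\<dots> \<le> H n" by (rule H_ge[OF p2])
    finally show ?thesis by blast
  qed
  show ?thesis
    using gt2 lt2 mem easy hard by (metis not_less)
qed

end
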